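(* Let $m\ge 2$ be an integer and let $\delta>-m$ be real. For each of the preferential attachment models (a), (b), (c) and for every $\varepsilon\in(0,1)$, the diameter of $G_{m,\delta}(t)$ is, with high probability as $t\to\infty$, bounded below by $\frac{\varepsilon}{\log m}\log\log t$.
   Context: Preferential attachment models. For an integer $m\ge1$ and a real $\delta\ge -m$, $G_{m,\delta}(t)$ is a random multigraph with vertex set $[t]=\{1,\dots,t\}$ and $mt$ edges. $D_i(t)$ denotes the degree of vertex $i$ at time $t$ (a self-loop adds 2 to the degree). Model (a), $m=1$: $G_{1,\delta}(1)$ is one vertex with one self-loop. Given $G_{1,\delta}(t)$, a vertex $t+1$ with a single edge is added; the other end point of the edge is $t+1$ itself with probability $\frac{1+\delta}{t(2+\delta)+(1+\delta)}$, and is $i\in[t]$ with probability $\frac{D_i(t)+\delta}{t(2+\delta)+(1+\delta)}$. For $m>1$: put $\delta'=\delta/m$, take $G_{1,\delta'}(mt)$, and for each $1\le j\le t$ merge its vertices $(j-1)m+1,\dots,jm$ into the single vertex $j$ of $G_{m,\delta}(t)$ (keeping all edges). Model (b), $m=1$: start from $G_{1,\delta}(2)$, consisting of vertices $1,2$ joined by 2 edges. For $t\ge2$, given $G_{1,\delta}(t)$, vertex $t+1$ with a single edge is added, attached to $i\in[t]$ with probability $\frac{D_i(t)+\delta}{t(2+\delta)}$. For $m>1$, $G_{m,\delta}(t)$ is obtained from $G_{1,\delta/m}(mt)$ by the same merging as in model (a). Model (c), $m\ge1$: start from $G_{m,\delta}(2)$, consisting of vertices $1,2$ joined by $2m$ edges.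 For $t\ge2$, given $G_{m,\delta}(t)$, vertex $t+1$ is added with $m$ edges whose other end points are chosen independently, each equal to $i\in[t]$ with probability $\frac{D_i(t)+\delta}{t(2m+\delta)}$. Diameter: $\mathrm{diam}(G)=\max\{\mathrm{dist}_G(i,j): i,j\in G,\ \mathrm{dist}_G(i,j)<\infty\}$, with $\mathrm{dist}_G$ the graph distance. A sequence of events $A_t$ occurs with high probability if $\mathbb P(A_t)\to1$ as $t\to\infty$. *)

theory Defs
  imports "HOL-Probability.Probability" "HOL-Library.Uprod"
begin

subsection \<open>Finite multigraphs with loops\<close>

text \<open>The multiplicity of an edge is its multiplicity in the multiset of edges; the loop at a vertex
  \<open>i\<close> is the edge \<open>Upair i i\<close>.\<close>

datatype multigraph = Multigraph (verts: "nat set") (edges: "nat uprod multiset")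

definition vdegree :: "multigraph \<Rightarrow> nat \<Rightarrow> nat" where
  "vdegree G i = size {#e \<in># edges G. i \<in> set_uprod e#} + count (edges G) (Upair i i)"

definition adjacency :: "multigraph \<Rightarrow> (nat \<times> nat) set" where
  "adjacency G = {(i, j). Upair i j \<in># edges G}"

text \<open>The distance is \<open>\<infinity>\<close> (the infimum of the empty set) if no path joins the two vertices.\<close>

definition gdist :: "multigraph \<Rightarrow> nat \<Rightarrow> nat \<Rightarrow> enat" where
  "gdist G i j = (INF n \<in> {n. (i, j) \<in> adjacency G ^^ n}. enat n)"

text \<open>Only finite distances enter the maximum.\<close>

definition diam :: "multigraph \<Rightarrow> nat" where
  "diam G = Max {n. \<exists>i\<in>verts G. \<exists>j\<in>verts G. gdist G i j = enat n}"

definition add_vertex :: "nat \<Rightarrow> nat list \<Rightarrow> multigraph \<Rightarrow> multigraph" where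
  "add_vertex v js G =
     Multigraph (insert v (verts G)) (edges G + mset (map (\<lambda>j. Upair v j) js))"

text \<open>Merging identifies the vertices \<open>(j - 1) * m + 1, \<dots>, j * m\<close> to the vertex \<open>j\<close>, for every
  \<open>j \<ge> 1\<close>.\<close>

definition block :: "nat \<Rightarrow> nat \<Rightarrow> nat" where
  "block m v = (v - 1) div m + 1"

definition merge :: "nat \<Rightarrow> multigraph \<Rightarrow> multigraph" where
  "merge m G = Multigraph (block m ` verts G) (image_mset (map_uprod (block m)) (edges G))"


subsection \<open>Laws of the end points\<close>

text \<open>The argument of \<open>embed_pmf\<close> is a probability mass function for every graph that the models below
  can reach at time \<open>t\<close>, provided that \<open>\<delta> > -1\<close> (model (a)) or \<open>\<delta> > -m\<close> (models (b), (c)); this is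
  proved at the end of this theory.\<close>

text \<open>Model (a): the new vertex \<open>t + 1\<close> may be its own neighbour.\<close>

definition endpoint_loop :: "real \<Rightarrow> nat \<Rightarrow> multigraph \<Rightarrow> nat pmf" where
  "endpoint_loop \<delta> t G = embed_pmf (\<lambda>i.
     if i \<in> {1..t} then (real (vdegree G i) + \<delta>) / (real t * (2 + \<delta>) + (1 + \<delta>))
     else if i = t + 1 then (1 + \<delta>) / (real t * (2 + \<delta>) + (1 + \<delta>))
     else 0)"

text \<open>Model (c), and for \<open>m = 1\<close> also model (b).\<close>

definition endpoint_old :: "nat \<Rightarrow> real \<Rightarrow> nat \<Rightarrow> multigraph \<Rightarrow> nat pmf" where
  "endpoint_old m \<delta> t G = embed_pmf (\<lambda>i.
     if i \<in> {1..t} then (real (vdegree G i) + \<delta>) / (real t * (2 * real m + \<delta>)) else 0)"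


subsection \<open>The preferential attachment models\<close>

text \<open>\<open>evolve t0 G step t\<close> is the law at time \<open>t\<close> of the Markov chain which is \<open>G\<close> at time \<open>t0\<close> and
  whose transition kernel from time \<open>t\<close> to time \<open>t + 1\<close> is \<open>step t\<close>; for times before \<open>t0\<close> the value
  is irrelevant and set to \<open>G\<close>.\<close>

primrec evolve :: "nat \<Rightarrow> 'a \<Rightarrow> (nat \<Rightarrow> 'a \<Rightarrow> 'a pmf) \<Rightarrow> nat \<Rightarrow> 'a pmf" where
  "evolve t0 G step 0 = return_pmf G"
| "evolve t0 G step (Suc t) =
     (if t < t0 then return_pmf G else bind_pmf (evolve t0 G step t) (step t))"

definition PA1_a :: "real \<Rightarrow> nat \<Rightarrow> multigraph pmf" where
  "PA1_a \<delta> = evolve 1 (Multigraph {1} {#Upair 1 1#})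
     (\<lambda>t G. map_pmf (\<lambda>j. add_vertex (t + 1) [j] G) (endpoint_loop \<delta> t G))"

definition PA_a :: "nat \<Rightarrow> real \<Rightarrow> nat \<Rightarrow> multigraph pmf" where
  "PA_a m \<delta> t = map_pmf (merge m) (PA1_a (\<delta> / real m) (m * t))"

definition PA1_b :: "real \<Rightarrow> nat \<Rightarrow> multigraph pmf" where
  "PA1_b \<delta> = evolve 2 (Multigraph {1, 2} (replicate_mset 2 (Upair 1 2)))
     (\<lambda>t G. map_pmf (\<lambda>j. add_vertex (t + 1) [j] G) (endpoint_old 1 \<delta> t G))"

definition PA_b :: "nat \<Rightarrow> real \<Rightarrow> nat \<Rightarrow> multigraph pmf" where
  "PA_b m \<delta> t = map_pmf (merge m) (PA1_b (\<delta> / real m) (m * t))"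

definition PA_c :: "nat \<Rightarrow> real \<Rightarrow> nat \<Rightarrow> multigraph pmf" where
  "PA_c m \<delta> = evolve 2 (Multigraph {1, 2} (replicate_mset (2 * m) (Upair 1 2)))
     (\<lambda>t G. map_pmf (\<lambda>js. add_vertex (t + 1) js G) (replicate_pmf m (endpoint_old m \<delta> t G)))"


subsection \<open>The laws of the end points are well defined\<close>

definition pa_graph :: "nat \<Rightarrow> nat \<Rightarrow> multigraph \<Rightarrow> bool" where
  "pa_graph m t G \<longleftrightarrow> verts G = {1..t} \<and> size (edges G) = m * t \<and>
     (\<forall>e \<in># edges G. set_uprod e \<subseteq> {1..t}) \<and> (\<forall>i\<in>{1..t}. m \<le> vdegree G i)"

lemma sum_degree:
  assumes "finite V" "\<forall>e \<in># edges G. set_uprod e \<subseteq> V"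
  shows "(\<Sum>i\<in>V. vdegree G i) = 2 * size (edges G)"
proof -
  have "(\<Sum>i\<in>V. size {#e \<in># E. i \<in> set_uprod e#} + count E (Upair i i)) = 2 * size E"
    if "\<forall>e \<in># E. set_uprod e \<subseteq> V" for E :: "nat uprod multiset"
    using that
  proof (induction E)
    case empty
    then show ?case by simp
  next
    case (add e E)
    obtain a b where e: "e = Upair a b" by (cases e)
    have ab: "a \<in> V" "b \<in> V" using add.prems e by auto
    have "(\<Sum>i\<in>V. size {#e' \<in># add_mset e E. i \<in> set_uprod e'#} + count (add_mset e E) (Upair i i)) =
      (\<Sum>i\<in>V. (size {#e' \<in># E. i \<in> set_uprod e'#} + count E (Upair i i)) +
         ((if i = a then 1 else 0) + (if i = b then 1 else 0)))"
      by (rule sum.cong) (auto simp: e)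
    also have "\<dots> = 2 * size E + 2"
      using add.IH add.prems ab assms(1) by (simp only: sum.distrib) (simp add: sum.distrib)
    finally show ?case by simp
  qed
  from this[OF assms(2)] show ?thesis by (simp add: vdegree_def)
qed

lemma pmf_embed_finite:
  assumes "finite A" "\<And>x. 0 \<le> f x" "\<And>x. x \<notin> A \<Longrightarrow> f x = 0" "sum f A = 1"
  shows "pmf (embed_pmf f) x = f x"
proof (rule pmf_embed_pmf)
  have "(\<integral>\<^sup>+x. ennreal (f x) \<partial>count_space UNIV) = (\<Sum>x\<in>A. ennreal (f x))"
    using assms by (intro nn_integral_count_space') auto
  then show "(\<integral>\<^sup>+x. ennreal (f x) \<partial>count_space UNIV) = 1"
    using assms by (simp add: sum_ennreal)
qed (use assms in auto)

lemma pmf_endpoint_old: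
  assumes G: "pa_graph m t G" and "m \<ge> 1" "t \<ge> 1" "\<delta> > - real m"
  shows "pmf (endpoint_old m \<delta> t G) i =
    (if i \<in> {1..t} then (real (vdegree G i) + \<delta>) / (real t * (2 * real m + \<delta>)) else 0)"
  unfolding endpoint_old_def
proof (rule pmf_embed_finite[where A = "{1..t}"])
  have pos: "real t * (2 * real m + \<delta>) > 0" using assms by (intro mult_pos_pos) auto
  show "0 \<le> (if i \<in> {1..t} then (real (vdegree G i) + \<delta>) / (real t * (2 * real m + \<delta>)) else 0)" for i
  proof (cases "i \<in> {1..t}")
    case True
    then have "real m \<le> real (vdegree G i)" using G by (simp add: pa_graph_def)
    then show ?thesis using pos assms(4) by auto
  qed auto
  have "(\<Sum>i\<in>{1..t}. real (vdegree G i)) = real (2 * (m * t))"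
    using sum_degree[of "{1..t}" G] G by (simp add: pa_graph_def flip: of_nat_sum)
  then show "(\<Sum>i\<in>{1..t}. if i \<in> {1..t} then (real (vdegree G i) + \<delta>) / (real t * (2 * real m + \<delta>)) else 0) = 1"
  proof -
    have "(\<Sum>i\<in>{1..t}. if i \<in> {1..t} then (real (vdegree G i) + \<delta>) / (real t * (2 * real m + \<delta>)) else 0) =
      (real (2 * (m * t)) + real t * \<delta>) / (real t * (2 * real m + \<delta>))"
      using \<open>(\<Sum>i\<in>{1..t}. real (vdegree G i)) = real (2 * (m * t))\<close>
      by (simp add: sum.distrib flip: sum_divide_distrib)
    also have "real (2 * (m * t)) + real t * \<delta> = real t * (2 * real m + \<delta>)"
      by (simp add: algebra_simps)
    also have "real t * (2 * real m + \<delta>) / (real t * (2 * real m + \<delta>)) = 1"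
      using pos by (metis divide_self less_irrefl)
    finally show ?thesis .
  qed
qed auto

lemma pmf_endpoint_loop:
  assumes G: "pa_graph 1 t G" and "t \<ge> 1" "\<delta> > - 1"
  shows "pmf (endpoint_loop \<delta> t G) i =
    (if i \<in> {1..t} then (real (vdegree G i) + \<delta>) / (real t * (2 + \<delta>) + (1 + \<delta>))
     else if i = t + 1 then (1 + \<delta>) / (real t * (2 + \<delta>) + (1 + \<delta>)) else 0)"
  unfolding endpoint_loop_def
proof (rule pmf_embed_finite[where A = "{1..t+1}"])
  let ?f = "\<lambda>i. if i \<in> {1..t} then (real (vdegree G i) + \<delta>) / (real t * (2 + \<delta>) + (1 + \<delta>))
     else if i = t + 1 then (1 + \<delta>) / (real t * (2 + \<delta>) + (1 + \<delta>)) else 0"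
  have pos: "real t * (2 + \<delta>) + (1 + \<delta>) > 0" using assms by (smt (verit) mult_pos_pos of_nat_0_less_iff One_nat_def Suc_le_lessD)
  show "0 \<le> ?f i" for i
  proof (cases "i \<in> {1..t}")
    case True
    then have "1 \<le> vdegree G i" using G by (simp add: pa_graph_def)
    then show ?thesis using pos assms(3) True by auto
  next
    case False
    then show ?thesis using pos assms(3) by auto
  qed
  have *: "(\<Sum>i\<in>{1..t}. real (vdegree G i)) = real (2 * t)"
    using sum_degree[of "{1..t}" G] G by (simp add: pa_graph_def flip: of_nat_sum)
  have "{1..t+1} = insert (t+1) {1..t}" by auto
  then have "sum ?f {1..t+1} = ?f (t+1) + sum ?f {1..t}" by simp
  also have "sum ?f {1..t} = (real (2 * t) + real t * \<delta>) / (real t * (2 + \<delta>) + (1 + \<delta>))"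
    using * by (simp add: sum.distrib flip: sum_divide_distrib)
  also have "?f (t+1) + \<dots> = 1"
    using pos by (simp add: algebra_simps flip: add_divide_distrib)
  finally show "sum ?f {1..t+1} = 1" .
qed auto

lemma pa_graph_add_vertex:
  assumes G: "pa_graph m t G" and js: "length js = m" "set js \<subseteq> {1..t+1}"
  shows "pa_graph m (Suc t) (add_vertex (Suc t) js G)"
proof -
  have "m \<le> vdegree (add_vertex (Suc t) js G) i" if "i \<in> {1..Suc t}" for i
  proof (cases "i = Suc t")
    case True
    have "size {#e \<in># mset (map (Upair (Suc t)) js). Suc t \<in> set_uprod e#} = length js"
      by (induction js) auto
    then show ?thesis using True js by (simp add: vdegree_def add_vertex_def)
  next
    case False
    then have "m \<le> vdegree G i" using G that by (auto simp: pa_graph_def)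
    then show ?thesis by (simp add: vdegree_def add_vertex_def)
  qed
  moreover have "set_uprod e \<subseteq> {1..Suc t}" if "e \<in># edges (add_vertex (Suc t) js G)" for e
  proof -
    from that consider "e \<in># edges G" | j where "j \<in> set js" "e = Upair (Suc t) j"
      by (auto simp: add_vertex_def)
    then show ?thesis
    proof cases
      case 1
      then have "set_uprod e \<subseteq> {1..t}" using G by (auto simp: pa_graph_def)
      also have "\<dots> \<subseteq> {1..Suc t}" by auto
      finally show ?thesis .
    next
      case 2
      then show ?thesis using js(2) by auto
    qed
  qed
  ultimately show ?thesis
    using G js by (auto simp: pa_graph_def add_vertex_def)
qed

lemma pa_graph_evolve:
  assumes "pa_graph m t0 G0" "t0 \<le> t" "G \<in> set_pmf (evolve t0 G0 step t)"
    and step: "\<And>t G G'. t0 \<le> t \<Longrightarrow> pa_graph m t G \<Longrightarrow> G' \<in> set_pmf (step t G) \<Longrightarrow> pa_graph m (Suc t) G'"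
  shows "pa_graph m t G"
  using assms(2,3)
proof (induction t arbitrary: G)
  case 0
  then show ?case using assms(1) by simp
next
  case (Suc t)
  show ?case
  proof (cases "t < t0")
    case True
    then have "t0 = Suc t" using Suc.prems by simp
    then show ?thesis using Suc.prems assms(1) by simp
  next
    case False
    then show ?thesis using Suc.prems Suc.IH step by (auto simp: not_less)
  qed
qed

lemma set_pmf_eq_pos: "x \<in> set_pmf p \<longleftrightarrow> pmf p x \<noteq> 0"
  by (simp add: set_pmf_eq)

lemma pa_graph_PA1_a:
  assumes "\<delta> > - 1" "t \<ge> 1" "G \<in> set_pmf (PA1_a \<delta> t)"
  shows "pa_graph 1 t G"
  using _ assms(2) assms(3)[unfolded PA1_a_def]
proof (rule pa_graph_evolve)
  show "pa_graph 1 1 (Multigraph {1} {#Upair 1 1#})"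
    by (auto simp: pa_graph_def vdegree_def)
next
  fix t G G' assume *: "1 \<le> t" "pa_graph 1 t G"
    "G' \<in> set_pmf (map_pmf (\<lambda>j. add_vertex (t + 1) [j] G) (endpoint_loop \<delta> t G))"
  then obtain j where j: "j \<in> set_pmf (endpoint_loop \<delta> t G)" "G' = add_vertex (Suc t) [j] G" by auto
  have "j \<in> {1..t+1}"
    using j(1) * assms(1) by (auto simp: set_pmf_eq_pos pmf_endpoint_loop split: if_splits)
  then show "pa_graph 1 (Suc t) G'" unfolding j(2) using * by (intro pa_graph_add_vertex) auto
qed

lemma pa_graph_PA1_b:
  assumes "\<delta> > - 1" "t \<ge> 2" "G \<in> set_pmf (PA1_b \<delta> t)"
  shows "pa_graph 1 t G"
  using _ assms(2) assms(3)[unfolded PA1_b_def]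
proof (rule pa_graph_evolve)
  show "pa_graph 1 2 (Multigraph {1, 2} (replicate_mset 2 (Upair 1 2)))"
    by (auto simp: pa_graph_def vdegree_def numeral_2_eq_2)
next
  fix t G G' assume *: "2 \<le> t" "pa_graph 1 t G"
    "G' \<in> set_pmf (map_pmf (\<lambda>j. add_vertex (t + 1) [j] G) (endpoint_old 1 \<delta> t G))"
  then obtain j where j: "j \<in> set_pmf (endpoint_old 1 \<delta> t G)" "G' = add_vertex (Suc t) [j] G" by auto
  have "j \<in> {1..t+1}"
    using j(1) * assms(1) by (auto simp: set_pmf_eq_pos pmf_endpoint_old split: if_splits)
  then show "pa_graph 1 (Suc t) G'" unfolding j(2) using * by (intro pa_graph_add_vertex) auto
qed

lemma pa_graph_PA_c:
  assumes "m \<ge> 1" "\<delta> > - real m" "t \<ge> 2" "G \<in> set_pmf (PA_c m \<delta> t)"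
  shows "pa_graph m t G"
  using _ assms(3) assms(4)[unfolded PA_c_def]
proof (rule pa_graph_evolve)
  have "{#e \<in># replicate_mset n (Upair 1 2). i \<in> set_uprod e#} =
      (if i = 1 \<or> i = 2 then replicate_mset n (Upair 1 2) else {#})" for n and i :: nat
    by (induction n) auto
  then show "pa_graph m 2 (Multigraph {1, 2} (replicate_mset (2 * m) (Upair 1 2)))"
    by (auto simp: pa_graph_def vdegree_def)
next
  fix t G G' assume *: "2 \<le> t" "pa_graph m t G"
    "G' \<in> set_pmf (map_pmf (\<lambda>js. add_vertex (t + 1) js G) (replicate_pmf m (endpoint_old m \<delta> t G)))"
  then obtain js where js: "set js \<subseteq> set_pmf (endpoint_old m \<delta> t G)" "length js = m"
      "G' = add_vertex (Suc t) js G"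
    by (auto simp: set_replicate_pmf)
  have "set_pmf (endpoint_old m \<delta> t G) \<subseteq> {1..t+1}"
    using * assms(1,2) by (auto simp: set_pmf_eq_pos pmf_endpoint_old split: if_splits)
  then show "pa_graph m (Suc t) G'" unfolding js(3) using * js by (intro pa_graph_add_vertex) auto
qed

end

theory Submission
  imports Defs "HOL-Real_Asymp.Real_Asymp"
begin

text \<open>Orient every edge from the younger to the older end point. A vertex is good of depth \<open>k\<close> if no
  edge points to it and if, in the \<open>k\<close> generations below it, every vertex has only one parent, no
  vertex above the last generation has a loop, and all degrees are bounded. A walk of length less
  than \<open>k\<close> from a good vertex cannot leave these generations, so a vertex of generation \<open>k\<close> is at
  distance exactly \<open>k\<close>, and it remains to find one good vertex of depth \<open>k \<approx> \<epsilon> log log t / log m\<close>.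

  Let \<open>Z_j(s)\<close> be the number of good vertices of depth \<open>j\<close> at time \<open>s\<close>. A new vertex all of whose
  neighbours are good of depth \<open>j - 1\<close> is good of depth \<open>j\<close>, which has probability at least
  \<open>(c Z_{j-1}(s) / s)^m\<close>, and a good vertex is only destroyed by an edge to one of the at most
  \<open>m^(j+1)\<close> vertices below it, which has probability at most \<open>C m^(j+1) / s\<close>. The trees below
  different good vertices are disjoint, so one step changes \<open>Z_j\<close> by at most \<open>m\<close>. Compare \<open>Z_j\<close> on
  the time interval \<open>[t/2, t]\<close> with the solution \<open>w_j\<close> of the deterministic recursion
  \<open>w_j' = (1 - \<beta>_j) w_j + (c w_{j-1} / t)^m\<close>: the second moments of the deficits \<open>max 0 (w_j - Z_j)\<close>
  satisfy a linear recursion in time and depth, which bounds them by \<open>Q^(j+1) t\<close>. As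
  \<open>w_k \<ge> t exp (- R m^k)\<close> with \<open>m^k \<le> m (log t)^\<epsilon>\<close>, Chebyshev's inequality shows that
  \<open>Z_k > 0\<close> with high probability. In the models (a) and (b) the steps of this argument are the
  blocks of \<open>m\<close> steps of the underlying process with one edge per vertex.\<close>

subsection \<open>Good vertices\<close>

text \<open>Labels grow with time, so these are the edges from the younger to the older end point,
  without loops.\<close>

definition down :: "(nat \<times> nat) set \<Rightarrow> (nat \<times> nat) set" where
  "down A = {(x, y) \<in> A. y < x}"

definition level :: "(nat \<times> nat) set \<Rightarrow> nat \<Rightarrow> nat \<Rightarrow> nat set" where
  "level A i v = (down A ^^ i) `` {v}"

text \<open>A new vertex has degree at most \<open>2 * m\<close> (loops count twice), and being chosen by one later vertex adds
  at most \<open>m\<close>; this gives the two degree bounds.\<close>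

definition good :: "nat \<Rightarrow> (nat \<times> nat) set \<Rightarrow> (nat \<Rightarrow> nat) \<Rightarrow> nat \<Rightarrow> nat \<Rightarrow> bool" where
  "good m A d k v \<longleftrightarrow>
     d v \<le> 2 * m \<and> v \<notin> Range (down A) \<and> level A k v \<noteq> {} \<and>
     (\<forall>i<k. \<forall>u\<in>level A i v. (u, u) \<notin> A) \<and>
     (\<forall>i\<le>k. \<forall>u\<in>level A i v. d u \<le> 3 * m \<and> card (down A `` {u}) \<le> m \<and>
        (\<forall>p p'. (p, u) \<in> down A \<longrightarrow> (p', u) \<in> down A \<longrightarrow> p = p'))"

lemma level_0 [simp]: "level A 0 v = {v}"
  by (simp add: level_def)

lemma level_Suc: "level A (Suc i) v = down A `` level A i v"
  by (auto simp: level_def)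

lemma level_Suc_first: "level A (Suc i) v = (\<Union>b\<in>down A `` {v}. level A i b)"
  unfolding level_def by (blast dest: relpow_Suc_D2 intro: relpow_Suc_I2)

text \<open>Parents are unique in these generations and a root has no parent, so climbing from
  \<open>u\<close> in either tree follows the same path and ends at the same root after the same
  number of steps. This yields the disjointness of different trees and of the generations of one
  tree.\<close>

lemma good_levels_inj:
  assumes "good m A d k v" "good m A d k' v'" "u \<in> level A i v" "u \<in> level A i' v'" "i \<le> k" "i' \<le> k'"
  shows "v = v' \<and> i = i'"
  using assms(3-6)
proof (induction i arbitrary: u i')
  case 0
  then have u: "u = v" by simp
  have "i' = 0"
  proof (rule ccontr)
    assume "i' \<noteq> 0"
    then obtain j where "i' = Suc j" by (cases i') auto
    with 0 u have "v \<in> Range (down A)" by (auto simp: level_Suc)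
    with assms(1) show False by (simp add: good_def)
  qed
  with 0 show ?case by simp
next
  case (Suc i)
  then obtain p where p: "p \<in> level A i v" "(p, u) \<in> down A" by (auto simp: level_Suc)
  have "i' \<noteq> 0"
    using Suc.prems(2) p(2) assms(2) by (auto simp: good_def)
  then obtain j where j: "i' = Suc j" by (cases i') auto
  with Suc.prems obtain p' where p': "p' \<in> level A j v'" "(p', u) \<in> down A"
    by (auto simp: level_Suc)
  have "p = p'"
    using assms(1) Suc.prems(1,3) p(2) p'(2) by (auto simp: good_def)
  with Suc.IH[of p j] p p' Suc.prems j show ?case by auto
qed

text \<open>Each step descends one generation or climbs to the unique parent. The bound
  \<open>n < k\<close> keeps the walk above the last generation, where loops are excluded, and from
  the root it can only descend.\<close>

lemma good_walk_level:
  assumes "good m A d k v" "sym A" "(v, x) \<in> A ^^ n" "n < k"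
  shows "\<exists>i\<le>n. x \<in> level A i v"
  using assms(3,4)
proof (induction n arbitrary: x)
  case 0
  then show ?case by auto
next
  case (Suc n)
  then obtain y where y: "(v, y) \<in> A ^^ n" "(y, x) \<in> A" by auto
  with Suc obtain i where i: "i \<le> n" "y \<in> level A i v" by force
  consider "x < y" | "x = y" | "y < x" by linarith
  then show ?case
  proof cases
    case 1
    then have "x \<in> level A (Suc i) v" using y i by (auto simp: level_Suc down_def)
    then show ?thesis using i by (intro exI[of _ "Suc i"]) simp
  next
    case 2
    then show ?thesis using y i Suc.prems assms(1) by (auto simp: good_def)
  next
    case 3
    then have xy: "(x, y) \<in> down A" using y assms(2) by (auto simp: down_def sym_def)
    then have "i \<noteq> 0" using i assms(1) by (auto simp: good_def)
    then obtain j where j: "i = Suc j" by (cases i) auto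
    with i obtain p where "p \<in> level A j v" "(p, y) \<in> down A" by (auto simp: level_Suc)
    moreover have "p = x"
      using assms(1) i Suc.prems xy \<open>(p, y) \<in> down A\<close> unfolding good_def
      by (meson Suc_leD le_trans less_imp_le_nat)
    ultimately show ?thesis using i j by (intro exI[of _ j]) simp
  qed
qed

section \<open>Good vertices and the diameter\<close>

lemma sym_adjacency: "sym (adjacency G)"
proof -
  have "Upair y x \<in># E" if "Upair x y \<in># E" for x y :: nat and E
    using that Upair_inject[of x y y x] by metis
  then show ?thesis unfolding sym_def adjacency_def by blast
qed

text \<open>The descending path has length \<open>k\<close>; a shorter walk would put
  \<open>u\<close> into an earlier generation as well.\<close>

lemma gdist_good:
  assumes "good m (adjacency G) d k v" "u \<in> level (adjacency G) k v"
  shows "gdist G v u = enat k"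
proof (rule antisym)
  have "down (adjacency G) \<subseteq> adjacency G" by (auto simp: down_def)
  then have "down (adjacency G) ^^ k \<subseteq> adjacency G ^^ k" by (induction k) (auto simp: relcomp_mono)
  then have "(v, u) \<in> adjacency G ^^ k" using assms(2) by (auto simp: level_def)
  then show "gdist G v u \<le> enat k" unfolding gdist_def by (intro INF_lower) simp
  show "enat k \<le> gdist G v u"
    unfolding gdist_def
  proof (intro INF_greatest, rule ccontr)
    fix n assume n: "n \<in> {n. (v, u) \<in> adjacency G ^^ n}" "\<not> enat k \<le> enat n"
    then obtain i where i: "i \<le> n" "u \<in> level (adjacency G) i v"
      using good_walk_level[OF assms(1) sym_adjacency, of u n] by auto
    with n good_levels_inj[OF assms(1,1) _ assms(2), of i] show False by auto
  qed
qed

lemma level_subset: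
  assumes "A \<subseteq> V \<times> V" "v \<in> V"
  shows "level A i v \<subseteq> V"
  using assms by (induction i) (auto simp: level_Suc down_def)

lemma diam_good:
  assumes "finite (verts G)" "adjacency G \<subseteq> verts G \<times> verts G" "v \<in> verts G"
    and "good m (adjacency G) d k v"
  shows "k \<le> diam G"
proof -
  let ?S = "{n. \<exists>i\<in>verts G. \<exists>j\<in>verts G. gdist G i j = enat n}"
  obtain u where u: "u \<in> level (adjacency G) k v" using assms(4) by (auto simp: good_def)
  \<comment> \<open>\<open>Max\<close> is meaningful only on a finite set; finite distances are
    values of a function on finitely many pairs.\<close>
  have "?S \<subseteq> (\<lambda>(i, j). the_enat (gdist G i j)) ` (verts G \<times> verts G)"
  proof
    fix n assume "n \<in> ?S"
    then obtain i j where "i \<in> verts G" "j \<in> verts G" "gdist G i j = enat n" by auto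
    then show "n \<in> (\<lambda>(i, j). the_enat (gdist G i j)) ` (verts G \<times> verts G)"
      by (intro image_eqI[of _ _ "(i, j)"]) auto
  qed
  then have "finite ?S" using assms(1) by (meson finite_SigmaI finite_imageI finite_subset)
  moreover have "k \<in> ?S"
    using assms(3) gdist_good[OF assms(4) u] u level_subset[OF assms(2,3), of k] by blast
  ultimately show ?thesis unfolding diam_def by (rule Max_ge)
qed

section \<open>Size of the tree below a good vertex\<close>

lemma card_level_le:
  assumes "finite A" "\<forall>j\<le>i. \<forall>u\<in>level A j v. card (down A `` {u}) \<le> m"
  shows "finite (level A i v) \<and> card (level A i v) \<le> m ^ i"
  using assms(2)
proof (induction i)
  case (Suc i)
  then have "\<forall>j\<le>i. \<forall>u\<in>level A j v. card (down A `` {u}) \<le> m" by (meson le_SucI)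
  then have IH: "finite (level A i v)" "card (level A i v) \<le> m ^ i" using Suc.IH by blast+
  have eq: "level A (Suc i) v = (\<Union>u\<in>level A i v. down A `` {u})" by (auto simp: level_Suc)
  have "finite (down A)" using assms(1) by (rule finite_subset[rotated]) (auto simp: down_def)
  then have fin: "finite (down A `` {u})" for u by (rule finite_Image)
  have "card (level A (Suc i) v) \<le> (\<Sum>u\<in>level A i v. card (down A `` {u}))"
    unfolding eq by (rule card_UN_le) (rule IH)
  also have "\<dots> \<le> (\<Sum>u\<in>level A i v. m)"
    using Suc.prems by (intro sum_mono) (meson le_SucI order_refl)
  also have "\<dots> \<le> m ^ Suc i" using IH by (simp add: mult.commute)
  finally show ?case using IH fin by (simp add: eq)
qed auto

definition tree :: "(nat \<times> nat) set \<Rightarrow> nat \<Rightarrow> nat \<Rightarrow> nat set" where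
  "tree A k v = (\<Union>i\<le>k. level A i v)"

lemma card_tree_le:
  assumes "finite A" "good m A d k v" "m \<ge> 2"
  shows "finite (tree A k v) \<and> card (tree A k v) \<le> m ^ Suc k"
proof -
  have lev: "finite (level A i v) \<and> card (level A i v) \<le> m ^ i" if "i \<le> k" for i
  proof (rule card_level_le[OF assms(1)])
    show "\<forall>j\<le>i. \<forall>u\<in>level A j v. card (down A `` {u}) \<le> m"
      using assms(2) le_trans[OF _ that] unfolding good_def by blast
  qed
  have "card (tree A k v) \<le> (\<Sum>i\<le>k. card (level A i v))"
    unfolding tree_def by (rule card_UN_le) simp
  also have "\<dots> \<le> (\<Sum>i\<le>k. m ^ i)" using lev by (intro sum_mono) auto
  also have "\<dots> \<le> m ^ Suc k"
  proof (induction k)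
    case (Suc k)
    then have "(\<Sum>i\<le>Suc k. m ^ i) \<le> 2 * m ^ Suc k" by simp
    also have "\<dots> \<le> m * m ^ Suc k" using assms(3) by (rule mult_right_mono) simp
    finally show ?case by simp
  qed (use assms(3) in simp)
  finally show ?thesis using lev by (auto simp: tree_def)
qed

text \<open>The set of neighbours of the new vertex \<open>v\<close> is recovered from the new graph as \<open>A' `` {v}\<close>.\<close>

definition attached ::
  "nat \<Rightarrow> nat \<Rightarrow> (nat \<times> nat) set \<Rightarrow> (nat \<Rightarrow> nat) \<Rightarrow> (nat \<times> nat) set \<Rightarrow> (nat \<Rightarrow> nat) \<Rightarrow> bool" where
  "attached m v A d A' d' \<longleftrightarrow>
     A' `` {v} \<subseteq> {1..v} \<and> A' `` {v} \<noteq> {} \<and> card (A' `` {v}) \<le> m \<and>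
     A' = A \<union> {v} \<times> A' `` {v} \<union> A' `` {v} \<times> {v} \<and>
     d' v \<le> 2 * m \<and> (\<forall>u. d u \<le> d' u) \<and> (\<forall>u\<in>{1..<v}. d' u \<le> d u + m) \<and>
     (\<forall>u\<in>{1..<v}. u \<notin> A' `` {v} \<longrightarrow> d' u = d u)"

section \<open>Good vertices after the attachment of one vertex\<close>

context
  fixes m v :: nat and A A' :: "(nat \<times> nat) set" and d d' :: "nat \<Rightarrow> nat"
  assumes att: "attached m v A d A' d'" and A: "A \<subseteq> {1..<v} \<times> {1..<v}"
begin

lemma down_attached: "down A' = down A \<union> {v} \<times> (A' `` {v} - {v})"
proof -
  have "A' = A \<union> {v} \<times> A' `` {v} \<union> A' `` {v} \<times> {v}" "A' `` {v} \<subseteq> {1..v}"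
    using att by (auto simp only: attached_def)
  then show ?thesis using A unfolding down_def by fastforce
qed

text \<open>All new oriented edges start at \<open>v\<close>, and no descent from an old vertex
  reaches \<open>v\<close>.\<close>

lemma level_attached_old:
  assumes "b < v" "1 \<le> b"
  shows "level A' i b = level A i b"
proof (induction i)
  case (Suc i)
  have "level A i b \<subseteq> {1..<v}" using A assms by (intro level_subset) auto
  then show ?case using Suc by (auto simp: level_Suc down_attached)
qed simp

text \<open>A tree without chosen vertices keeps its edges, degrees and parents.\<close>

lemma good_attached_old:
  assumes v0: "v0 \<in> {1..<v}" and good: "good m A d k v0" and avoid: "A' `` {v} \<inter> tree A k v0 = {}"
  shows "good m A' d' k v0"
proof -
  have lev: "level A' i v0 = level A i v0" for i using v0 by (intro level_attached_old) auto
  have u: "u \<in> {1..<v} \<and> u \<notin> A' `` {v}" if "i \<le> k" "u \<in> level A i v0" for i u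
    using that avoid A v0 level_subset[of A "{1..<v}" v0 i] by (auto simp: tree_def)
  have u0: "v0 \<notin> A' `` {v}" using u[of 0] by auto
  have d: "d' u = d u" if "i \<le> k" "u \<in> level A i v0" for i u
    using u[OF that] att unfolding attached_def by blast
  have A': "A' = A \<union> {v} \<times> A' `` {v} \<union> A' `` {v} \<times> {v}"
    using att by (auto simp only: attached_def)
  have loop: "(u, u) \<notin> A'" if "i < k" "u \<in> level A i v0" for i u
  proof -
    have "(u, u) \<notin> A" using that good by (auto simp: good_def)
    then show ?thesis using u[of i u] that A' by auto
  qed
  have dn: "down A' `` {u} = down A `` {u}" if "i \<le> k" "u \<in> level A i v0" for i u
    using u[OF that] by (auto simp: down_attached)
  have pr: "(p, u) \<in> down A' \<longleftrightarrow> (p, u) \<in> down A" if "i \<le> k" "u \<in> level A i v0" for i u p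
    using u[OF that] by (auto simp: down_attached)
  have "v0 \<notin> Range (down A')" "d' v0 \<le> 2 * m"
    using good u0 d[of 0 v0] by (auto simp: down_attached good_def)
  then show ?thesis
    using good loop unfolding good_def lev by (simp add: d dn pr)
qed

text \<open>Edges and degrees only grow, while the generations below an old vertex stay the same, so
  an attachment never turns an old vertex good. Hence \<open>v\<close> is the only possible
  gain.\<close>

lemma good_attached_rev:
  assumes v0: "v0 \<in> {1..<v}" and good: "good m A' d' k v0"
  shows "good m A d k v0"
proof -
  have lev: "level A' i v0 = level A i v0" for i using v0 by (intro level_attached_old) auto
  have A': "A \<subseteq> A'" "down A \<subseteq> down A'"
    using att unfolding attached_def by (blast, auto simp: down_attached)
  have u: "u \<in> {1..<v}" if "u \<in> level A i v0" for i u
    using that A v0 level_subset[of A "{1..<v}" v0 i] by auto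
  have dn: "down A' `` {u} = down A `` {u}" if "u \<in> level A i v0" for i u
    using u[OF that] by (auto simp: down_attached)
  have d: "d u \<le> d' u" for u using att unfolding attached_def by blast
  have "v0 \<notin> Range (down A)" "d v0 \<le> 2 * m"
    using good A' d[of v0] by (auto simp: good_def)
  moreover have "(u, u) \<notin> A" if "i < k" "u \<in> level A i v0" for i u
    using that good A' by (auto simp: good_def lev)
  moreover have "d u \<le> 3 * m \<and> card (down A `` {u}) \<le> m \<and>
      (\<forall>p p'. (p, u) \<in> down A \<longrightarrow> (p', u) \<in> down A \<longrightarrow> p = p')" if "i \<le> k" "u \<in> level A i v0" for i u
  proof -
    have "d' u \<le> 3 * m" "card (down A' `` {u}) \<le> m"
      "\<forall>p p'. (p, u) \<in> down A' \<longrightarrow> (p', u) \<in> down A' \<longrightarrow> p = p'"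
      using good that unfolding good_def lev by blast+
    moreover from this(1) have "d u \<le> 3 * m" using d[of u] by simp
    ultimately show ?thesis using A'(2) unfolding dn[OF that(2)] by blast
  qed
  moreover have "level A k v0 \<noteq> {}" using good by (simp add: good_def lev)
  ultimately show ?thesis unfolding good_def by simp
qed

text \<open>For \<open>k > 0\<close> the chosen vertices become the first generation. Being roots,
  they have degree at most \<open>2 * m\<close> and no parent, so \<open>v\<close> becomes their
  only parent and their degrees stay within \<open>3 * m\<close>.\<close>

lemma good_attached_new:
  assumes k: "k = 0 \<or> A' `` {v} \<subseteq> {u \<in> {1..<v}. good m A d (k - 1) u}"
  shows "good m A' d' k v"
proof -
  have B: "A' `` {v} \<subseteq> {1..v}" "A' `` {v} \<noteq> {}" "card (A' `` {v}) \<le> m" "d' v \<le> 2 * m"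
    and d_le: "\<forall>u\<in>{1..<v}. d' u \<le> d u + m" and d_eq: "\<forall>u\<in>{1..<v}. u \<notin> A' `` {v} \<longrightarrow> d' u = d u"
    using att by (auto simp only: attached_def)
  have A': "A' = A \<union> {v} \<times> A' `` {v} \<union> A' `` {v} \<times> {v}"
    using att by (auto simp only: attached_def)
  have dv: "down A' `` {v} \<subseteq> A' `` {v}" by (auto simp: down_def)
  moreover have "finite (A' `` {v})" using B(1) finite_subset by blast
  ultimately have cv: "card (down A' `` {v}) \<le> m" using B(3) card_mono order_trans by blast
  have rv: "v \<notin> Range (down A')" unfolding down_attached using A by (auto simp: down_def)
  show ?thesis
  proof (cases k)
    case 0
    show ?thesis unfolding 0 good_def using B cv rv by auto
  next
    case (Suc l)
    then have G: "u \<in> {1..<v}" "good m A d l u" if "(v, u) \<in> A'" for u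
      using k that by auto
    have dv': "down A' `` {v} = A' `` {v}" using G by (auto simp: down_def)
    have lev: "level A' (Suc i) v = (\<Union>b\<in>A' `` {v}. level A i b)" for i
      unfolding level_Suc_first dv' using G by (auto simp: level_attached_old)
    have v_notin: "(v, v) \<notin> A'" using G by force
    have ne: "level A' k v \<noteq> {}"
      unfolding Suc lev using B(2) G(2) by (fastforce simp: good_def)
    have old: "u \<in> {1..<v}" if "(v, b) \<in> A'" "u \<in> level A i b" for b u i
      using level_subset[OF A G(1)[OF that(1)], of i] that(2) by blast
    \<comment> \<open>A deeper vertex of a tree has a parent, a chosen vertex has none; hence deeper
      vertices gain neither a second parent nor degree.\<close>
    have nonroot: "(v, u) \<notin> A'" if "(v, b) \<in> A'" "u \<in> level A (Suc i) b" for b u i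
    proof
      assume "(v, u) \<in> A'"
      then have "u \<notin> Range (down A)" using G(2) by (auto simp: good_def)
      then show False using that(2) by (auto simp: level_Suc)
    qed
    have loops: "(u, u) \<notin> A'" if iu: "i < k" "u \<in> level A' i v" for i u
    proof (cases i)
      case (Suc j)
      then obtain b where b: "(v, b) \<in> A'" "u \<in> level A j b" using iu(2) unfolding Suc lev by auto
      then have "(u, u) \<notin> A" using G(2)[OF b(1)] that \<open>k = Suc l\<close> Suc by (auto simp: good_def)
      then show ?thesis using old[OF b] A' by auto
    qed (use that v_notin in simp)
    have nodes: "d' u \<le> 3 * m \<and> card (down A' `` {u}) \<le> m \<and>
        (\<forall>p p'. (p, u) \<in> down A' \<longrightarrow> (p', u) \<in> down A' \<longrightarrow> p = p')" if iu: "i \<le> k" "u \<in> level A' i v" for i u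
    proof (cases i)
      case 0
      then show ?thesis using that B cv rv by auto
    next
      case (Suc j)
      then obtain b where b: "(v, b) \<in> A'" "u \<in> level A j b" using iu(2) unfolding Suc lev by auto
      have u: "u \<in> {1..<v}" using old[OF b] .
      have gb: "d u \<le> 3 * m" "card (down A `` {u}) \<le> m"
        "\<And>p p'. (p, u) \<in> down A \<Longrightarrow> (p', u) \<in> down A \<Longrightarrow> p = p'"
        using G(2)[OF b(1)] b(2) that(1) unfolding \<open>k = Suc l\<close> Suc Suc_le_mono good_def by blast+
      have dn: "down A' `` {u} = down A `` {u}" using u by (auto simp: down_attached)
      show ?thesis
      proof (cases j)
        case 0
        then have "u = b" using b by simp
        then have "u \<notin> Range (down A)" "d u \<le> 2 * m" using G(2)[OF b(1)] by (auto simp: good_def)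
        then show ?thesis using d_le u gb dn by (fastforce simp: down_attached)
      next
        case (Suc j')
        then have "(v, u) \<notin> A'" using nonroot b by auto
        moreover from this have "d' u = d u" using d_eq u by auto
        ultimately show ?thesis using gb dn by (auto simp: down_attached)
      qed
    qed
    show ?thesis unfolding good_def using B rv ne loops nodes by blast
  qed
qed

end

subsection \<open>Second moments of deficits\<close>

text \<open>Boundedness makes the inner and outer integrands integrable, so the identity carries
  over from nonnegative integrals.\<close>

lemma expectation_bind_pmf:
  fixes f :: "'b \<Rightarrow> real"
  assumes "\<And>x. 0 \<le> f x" "\<And>x. f x \<le> b"
  shows "measure_pmf.expectation (bind_pmf p K) f =
    measure_pmf.expectation p (\<lambda>x. measure_pmf.expectation (K x) f)"
proof -
  have int: "integrable (measure_pmf q) f" for q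
    using assms by (intro measure_pmf.integrable_const_bound[where B = b]) auto
  have "0 \<le> measure_pmf.expectation (K x) f" "measure_pmf.expectation (K x) f \<le> b" for x
  proof -
    show "0 \<le> measure_pmf.expectation (K x) f" using assms(1) by (intro integral_nonneg_AE) auto
    show "measure_pmf.expectation (K x) f \<le> b"
      using assms by (intro measure_pmf.integral_le_const int) auto
  qed
  then have int': "integrable (measure_pmf p) (\<lambda>x. measure_pmf.expectation (K x) f)"
    by (intro measure_pmf.integrable_const_bound[where B = b]) auto
  have "ennreal (measure_pmf.expectation (bind_pmf p K) f) =
      (\<integral>\<^sup>+x. (\<integral>\<^sup>+y. ennreal (f y) \<partial>measure_pmf (K x)) \<partial>measure_pmf p)"
    using assms(1) by (simp add: nn_integral_eq_integral[OF int, symmetric])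
  also have "\<dots> = (\<integral>\<^sup>+x. ennreal (measure_pmf.expectation (K x) f) \<partial>measure_pmf p)"
    using assms(1) by (simp add: nn_integral_eq_integral[OF int])
  also have "\<dots> = ennreal (measure_pmf.expectation p (\<lambda>x. measure_pmf.expectation (K x) f))"
    using assms(1) by (intro nn_integral_eq_integral int') (auto intro: integral_nonneg_AE)
  finally show ?thesis
    using assms(1) by (simp add: integral_nonneg_AE)
qed

text \<open>Taylor bound for the squared positive part, whose derivative \<open>2 * max 0 x\<close>
  is 2-Lipschitz.\<close>

lemma max_add_square_le:
  fixes x \<Delta> :: real
  shows "(max 0 (x + \<Delta>))\<^sup>2 \<le> (max 0 x)\<^sup>2 + 2 * max 0 x * \<Delta> + \<Delta>\<^sup>2"
proof (cases "x + \<Delta> \<ge> 0")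
  case True
  show ?thesis
  proof (cases "x \<ge> 0")
    case False
    then have "(x + \<Delta>)\<^sup>2 \<le> \<Delta>\<^sup>2" using True by (intro power_mono) auto
    then show ?thesis using True False by simp
  qed (use True in \<open>simp add: power2_sum\<close>)
next
  case False
  have "0 \<le> (max 0 x + \<Delta>)\<^sup>2" by simp
  then show ?thesis using False by (simp add: power2_sum)
qed

text \<open>Here \<open>y\<close> and \<open>w\<close> are the present values of the random and the
  ideal quantity, \<open>Y\<close> and \<open>w'\<close> the next ones. The increment of their
  difference has size at most \<open>L + 1\<close> and mean at most
  \<open>(b0 - b) - \<beta> * (w - y)\<close>; \<open>M\<close> provides integrability.\<close>

lemma deficit_square_step:
  fixes p :: "'b pmf" and Y :: "'b \<Rightarrow> real"
  assumes Y: "\<And>x. \<bar>Y x\<bar> \<le> M" "\<And>x. x \<in> set_pmf p \<Longrightarrow> \<bar>Y x - y\<bar> \<le> L"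
    and w: "w \<le> w'" "w' \<le> w + 1" "w' = (1 - \<beta>) * w + b0" and "0 \<le> \<beta>"
    and drift: "(1 - \<beta>) * y + b \<le> measure_pmf.expectation p Y"
  shows "measure_pmf.expectation p (\<lambda>x. (max 0 (w' - Y x))\<^sup>2)
    \<le> (max 0 (w - y))\<^sup>2 + 2 * max 0 (w - y) * max 0 (b0 - b) + (L + 1)\<^sup>2"
proof -
  let ?D = "max 0 (w - y)" and ?\<Delta> = "\<lambda>x. (w' - w) - (Y x - y)"
  have "0 \<le> M" using Y(1)[of undefined] by simp
  have intY: "integrable (measure_pmf p) Y"
    using Y(1) by (intro measure_pmf.integrable_const_bound[where B = M]) auto
  have intD: "integrable (measure_pmf p) (\<lambda>x. (max 0 (w' - Y x))\<^sup>2)"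
  proof (rule measure_pmf.integrable_const_bound[where B = "(\<bar>w'\<bar> + M)\<^sup>2"])
    show "AE x in measure_pmf p. norm ((max 0 (w' - Y x))\<^sup>2) \<le> (\<bar>w'\<bar> + M)\<^sup>2"
    proof (rule AE_I2)
      fix x show "norm ((max 0 (w' - Y x))\<^sup>2) \<le> (\<bar>w'\<bar> + M)\<^sup>2"
        using Y(1)[of x] by (auto intro!: power_mono)
    qed
  qed simp
  have "measure_pmf.expectation p (\<lambda>x. (max 0 (w' - Y x))\<^sup>2) \<le>
      measure_pmf.expectation p (\<lambda>x. ?D\<^sup>2 + 2 * ?D * (w' - w + y) + (L + 1)\<^sup>2 - 2 * ?D * Y x)"
  proof (rule integral_mono_AE[OF intD])
    show "AE x in measure_pmf p. (max 0 (w' - Y x))\<^sup>2 \<le>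
        ?D\<^sup>2 + 2 * ?D * (w' - w + y) + (L + 1)\<^sup>2 - 2 * ?D * Y x"
      unfolding AE_measure_pmf_iff
    proof
      fix x assume x: "x \<in> set_pmf p"
      have "(max 0 (w' - Y x))\<^sup>2 \<le> ?D\<^sup>2 + 2 * ?D * ?\<Delta> x + (?\<Delta> x)\<^sup>2"
        using max_add_square_le[of "w - y" "?\<Delta> x"] by simp
      also have "(?\<Delta> x)\<^sup>2 \<le> (L + 1)\<^sup>2"
        using Y(2)[OF x] w(1,2) by (intro abs_le_square_iff[THEN iffD1]) auto
      finally show "(max 0 (w' - Y x))\<^sup>2 \<le>
          ?D\<^sup>2 + 2 * ?D * (w' - w + y) + (L + 1)\<^sup>2 - 2 * ?D * Y x"
        by (simp add: algebra_simps)
    qed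
  qed (use intY in simp)
  also have "\<dots> = ?D\<^sup>2 + 2 * ?D * (w' - w + y) + (L + 1)\<^sup>2 - 2 * ?D * measure_pmf.expectation p Y"
    using intY by (simp add: measure_pmf.prob_space)
  also have "\<dots> \<le> ?D\<^sup>2 + 2 * ?D * max 0 (b0 - b) + (L + 1)\<^sup>2"
  proof -
    have "w' - w + y - measure_pmf.expectation p Y \<le> (b0 - b) - \<beta> * (w - y)"
      using drift w(3) by (simp add: algebra_simps)
    then have "?D * (w' - w + y - measure_pmf.expectation p Y) \<le> ?D * ((b0 - b) - \<beta> * (w - y))"
      by (rule mult_left_mono) simp
    also have "\<dots> \<le> ?D * max 0 (b0 - b)"
    proof (cases "w - y \<ge> 0")
      case True
      then have "0 \<le> \<beta> * (w - y)" using assms(6) by simp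
      then show ?thesis by (intro mult_left_mono) auto
    qed simp
    finally show ?thesis by (simp add: algebra_simps)
  qed
  finally show ?thesis .
qed

text \<open>A discrete Gronwall inequality: \<open>n\<close> forcings of size \<open>h\<close> are
  each amplified at most \<open>n\<close> times.\<close>

lemma linear_recurrence_bound:
  fixes a :: "nat \<Rightarrow> real"
  assumes "a 0 \<le> 0" "\<And>n. n < N \<Longrightarrow> a (Suc n) \<le> (1 + \<kappa>) * a n + h" "0 \<le> \<kappa>" "0 \<le> h" "n \<le> N"
  shows "a n \<le> real n * h * (1 + \<kappa>) ^ n"
  using assms(5)
proof (induction n)
  case (Suc n)
  have "a (Suc n) \<le> (1 + \<kappa>) * a n + h" using Suc.prems assms(2) by simp
  also have "\<dots> \<le> (1 + \<kappa>) * (real n * h * (1 + \<kappa>) ^ n) + h * (1 + \<kappa>) ^ Suc n"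
    using Suc assms(3,4) one_le_power[of "1 + \<kappa>" "Suc n"]
    by (intro add_mono mult_left_mono) (auto simp: mult_le_cancel_left1 simp del: power_Suc)
  finally show ?case by (simp add: algebra_simps)
qed (use assms in simp)

text \<open>There are at most \<open>t\<close> steps, so the total growth factor is at most
  \<open>exp m\<close>. The forcing of depth \<open>j + 1\<close> is controlled by the bound for
  depth \<open>j\<close>, so each depth costs one more factor
  \<open>exp m * (m + 1) * S\<close>.\<close>

lemma coupled_recurrence_bound:
  fixes e :: "nat \<Rightarrow> nat \<Rightarrow> real" and m S t :: real
  assumes "\<And>j. j \<le> k \<Longrightarrow> e j 0 \<le> 0"
    and "\<And>n. n < N \<Longrightarrow> e 0 (Suc n) \<le> (1 + m / t) * e 0 n + S"
    and "\<And>j n. j < k \<Longrightarrow> n < N \<Longrightarrow> e (Suc j) (Suc n) \<le> (1 + m / t) * e (Suc j) n + (m / t * e j n + S)"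
    and "real N \<le> t" "0 < t" "0 \<le> m" "1 \<le> S" "j \<le> k" "n \<le> N"
  shows "e j n \<le> (exp m * (m + 1) * S) ^ Suc j * t"
  using assms(8,9)
proof (induction j arbitrary: n)
  have growth: "real n * h * (1 + m / t) ^ n \<le> exp m * h * t" if "0 \<le> h" "n \<le> N" for h n
  proof -
    have nt: "real n \<le> t" using that assms(4) by linarith
    have "(1 + m / t) ^ n \<le> exp (m / t) ^ n"
      using assms(5,6) by (intro power_mono) (auto simp: exp_ge_add_one_self)
    also have "\<dots> = exp (real n * (m / t))" by (rule exp_of_nat_mult[symmetric])
    also have "\<dots> \<le> exp m"
      using mult_right_mono[OF nt assms(6)] assms(5) by (simp add: field_simps)
    finally have "real n * h * (1 + m / t) ^ n \<le> t * h * exp m"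
      using nt that assms(5,6) by (intro mult_mono) auto
    then show ?thesis by (simp add: mult_ac)
  qed
  {
    case 0
    have "e 0 n \<le> real n * S * (1 + m / t) ^ n"
      using 0 assms by (intro linear_recurrence_bound[of "e 0" N]) auto
    also have "\<dots> \<le> exp m * S * t" using growth[of S n] 0 assms by simp
    also have "\<dots> \<le> exp m * (m + 1) * S * t" using assms by (simp add: mult_right_mono)
    finally show ?case by simp
  next
    case (Suc j)
    let ?Q = "exp m * (m + 1) * S"
    have Q: "1 \<le> ?Q" using assms(6,7) mult_mono[of 1 "exp m * (m + 1)" 1 S] mult_mono[of 1 "exp m" 1 "m + 1"] by simp
    let ?h = "m * ?Q ^ Suc j + S"
    have h: "0 \<le> ?h" using Q assms(6,7) by (intro add_nonneg_nonneg mult_nonneg_nonneg zero_le_power) auto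
    have "e (Suc j) n \<le> real n * ?h * (1 + m / t) ^ n"
    proof (rule linear_recurrence_bound[of "e (Suc j)" N])
      fix n assume n: "n < N"
      have "m / t * e j n \<le> m / t * (?Q ^ Suc j * t)"
        using Suc.IH[of n] Suc.prems n assms(5,6) by (intro mult_left_mono) auto
      also have "\<dots> = m * ?Q ^ Suc j" using assms(5) by simp
      finally show "e (Suc j) (Suc n) \<le> (1 + m / t) * e (Suc j) n + ?h"
        using assms(3)[of j n] Suc.prems n by simp
    qed (use assms Suc.prems h in auto)
    also have "\<dots> \<le> exp m * ?h * t" using growth[OF h, of n] Suc.prems by simp
    also have "?h \<le> (m + 1) * S * ?Q ^ Suc j"
    proof -
      have Q1: "1 \<le> ?Q ^ Suc j" using Q by (rule one_le_power)
      have "S \<le> S * ?Q ^ Suc j" using mult_left_mono[OF Q1, of S] assms(7) by simp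
      moreover have "m * ?Q ^ Suc j \<le> (m * S) * ?Q ^ Suc j"
        using Q1 mult_left_mono[OF assms(7), of m] assms(6) by (intro mult_right_mono) auto
      ultimately show ?thesis by (simp add: algebra_simps)
    qed
    finally have "e (Suc j) n \<le> exp m * ((m + 1) * S * ?Q ^ Suc j) * t"
      using assms(5) by (simp add: mult_right_mono)
    then show ?case by (simp add: mult_ac)
  }
qed

text \<open>The functions \<open>w_j\<close> of the introduction, with \<open>n\<close> the number of steps since time \<open>t/2\<close>.\<close>

primrec profile :: "(nat \<Rightarrow> real) \<Rightarrow> (real \<Rightarrow> real) \<Rightarrow> nat \<Rightarrow> nat \<Rightarrow> real" where
  "profile \<beta> g 0 = (\<lambda>j. 0)"
| "profile \<beta> g (Suc n) =
     (\<lambda>j. (1 - \<beta> j) * profile \<beta> g n j + (case j of 0 \<Rightarrow> 1 | Suc i \<Rightarrow> g (profile \<beta> g n i)))"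

lemma profile_bounds:
  assumes \<beta>: "\<And>j. j \<le> k \<Longrightarrow> 0 \<le> \<beta> j \<and> \<beta> j \<le> 1"
    and g: "\<And>x y. 0 \<le> x \<Longrightarrow> x \<le> y \<Longrightarrow> y \<le> t \<Longrightarrow> 0 \<le> g x \<and> g x \<le> g y \<and> g y \<le> 1"
    and "real n \<le> t" "j \<le> k"
  shows "0 \<le> profile \<beta> g n j" "profile \<beta> g n j \<le> real n"
proof -
  have "0 \<le> profile \<beta> g n j \<and> profile \<beta> g n j \<le> real n"
    using assms(3,4)
  proof (induction n arbitrary: j)
    case (Suc n)
    have p: "0 \<le> profile \<beta> g n i" "profile \<beta> g n i \<le> real n" if "i \<le> k" for i
      using Suc that by auto
    have "0 \<le> (1 - \<beta> j) * profile \<beta> g n j" "(1 - \<beta> j) * profile \<beta> g n j \<le> 1 * profile \<beta> g n j"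
      using \<beta>[of j] p[of j] Suc.prems mult_right_mono[of "1 - \<beta> j" 1 "profile \<beta> g n j"] by auto
    moreover have "0 \<le> g (profile \<beta> g n i)" "g (profile \<beta> g n i) \<le> 1" if "Suc i = j" for i
      using p[of i] g[of "profile \<beta> g n i" "profile \<beta> g n i"] Suc.prems that by auto
    ultimately show ?case using p[of j] Suc.prems 
      by (cases j; force)
  qed simp
  then show "0 \<le> profile \<beta> g n j" "profile \<beta> g n j \<le> real n" by auto
qed

text \<open>Monotonicity in time propagates from the zero start, as \<open>g\<close> is monotone and
  \<open>1 - \<beta> j\<close> nonnegative; the bound on \<open>n\<close> keeps the profile in the
  range where \<open>g\<close> is controlled.\<close>

lemma profile_step:
  assumes \<beta>: "\<And>j. j \<le> k \<Longrightarrow> 0 \<le> \<beta> j \<and> \<beta> j \<le> 1"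
    and g: "\<And>x y. 0 \<le> x \<Longrightarrow> x \<le> y \<Longrightarrow> y \<le> t \<Longrightarrow> 0 \<le> g x \<and> g x \<le> g y \<and> g y \<le> 1"
    and "real (Suc n) \<le> t" "j \<le> k"
  shows "profile \<beta> g n j \<le> profile \<beta> g (Suc n) j" "profile \<beta> g (Suc n) j \<le> profile \<beta> g n j + 1"
proof -
  note bnd = profile_bounds[where \<beta> = \<beta> and g = g and t = t and k = k, OF \<beta> g]
  show "profile \<beta> g n j \<le> profile \<beta> g (Suc n) j"
    using assms(3,4)
  proof (induction n arbitrary: j)
    case 0
    then show ?case using bnd(1)[of 1 j] by simp
  next
    case (Suc n)
    have "(1 - \<beta> j) * profile \<beta> g n j \<le> (1 - \<beta> j) * profile \<beta> g (Suc n) j"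
      using Suc \<beta>[of j] by (intro mult_left_mono) auto
    moreover have "g (profile \<beta> g n i) \<le> g (profile \<beta> g (Suc n) i)" if "j = Suc i" for i
      using Suc.IH[of i] Suc.prems that bnd[of n i] bnd[of "Suc n" i] g by simp
    ultimately show ?case
      by (subst (1 2) profile.simps(2)) (auto split: nat.split simp del: profile.simps)
  qed
  have "(1 - \<beta> j) * profile \<beta> g n j \<le> 1 * profile \<beta> g n j"
    using \<beta>[of j] bnd(1)[of n j] assms by (intro mult_right_mono) auto
  moreover have "g (profile \<beta> g n i) \<le> 1" if "j = Suc i" for i
    using bnd[of n i] g[of "profile \<beta> g n i" "profile \<beta> g n i"] assms(3,4) that by simp
  ultimately show "profile \<beta> g (Suc n) j \<le> profile \<beta> g n j + 1"
    by (auto split: nat.split)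
qed

text \<open>The map \<open>\<lambda>x. (1 - \<beta>) * x + b\<close> has the fixed point
  \<open>b / \<beta>\<close>, and after \<open>1 / \<beta>\<close> steps the gap to it has shrunk by
  the factor \<open>exp (- 1)\<close>, which is below 1/2.\<close>

lemma relaxation_bound:
  fixes a :: "nat \<Rightarrow> real"
  assumes "0 \<le> a n1" "\<And>n. n1 \<le> n \<Longrightarrow> n < N \<Longrightarrow> (1 - \<beta>) * a n + b \<le> a (Suc n)"
    and "0 < \<beta>" "\<beta> \<le> 1" "0 \<le> b" "n1 \<le> n" "n \<le> N" "1 \<le> \<beta> * (real n - real n1)"
  shows "b / (2 * \<beta>) \<le> a n"
proof -
  have "b / \<beta> * (1 - (1 - \<beta>) ^ l) \<le> a (n1 + l)" if "n1 + l \<le> N" for l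
    using that
  proof (induction l)
    case (Suc l)
    have "b / \<beta> * (1 - (1 - \<beta>) ^ Suc l) = (1 - \<beta>) * (b / \<beta> * (1 - (1 - \<beta>) ^ l)) + b"
      using assms(3) by (simp add: field_simps)
    also have "\<dots> \<le> (1 - \<beta>) * a (n1 + l) + b"
      using Suc assms(4) by (intro add_right_mono mult_left_mono) auto
    also have "\<dots> \<le> a (n1 + Suc l)" using assms(2)[of "n1 + l"] Suc.prems by simp
    finally show ?case .
  qed (use assms in simp)
  from this[of "n - n1"] assms(6,7) have *: "b / \<beta> * (1 - (1 - \<beta>) ^ (n - n1)) \<le> a n" by simp
  have "(1 - \<beta>) ^ (n - n1) \<le> exp (- \<beta>) ^ (n - n1)"
    using assms(4) exp_ge_add_one_self[of "- \<beta>"] by (intro power_mono) auto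
  also have "\<dots> = exp (- (\<beta> * (real n - real n1)))"
    using assms(6) by (simp add: exp_of_nat_mult[symmetric] of_nat_diff algebra_simps)
  also have "\<dots> \<le> exp (- 1)" using assms(8) by simp
  also have "\<dots> \<le> 1 / 2" using exp_ge_add_one_self[of 1] by (simp add: exp_minus field_simps)
  finally have "b / \<beta> * (1 / 2) \<le> b / \<beta> * (1 - (1 - \<beta>) ^ (n - n1))"
    using assms(3,5) by (intro mult_left_mono) auto
  with * show ?thesis by (simp add: field_simps)
qed

subsection \<open>Many good vertices in an attachment process\<close>

text \<open>Common frame for the three models. The state type is abstract because in models (a) and
  (b) the chain lives on the unmerged graphs, while \<open>A\<close> and \<open>d\<close> describe
  the merged ones. Attachment favours large degrees, hence the degree bound in \<open>hit\<close>.
  Enlarging \<open>C\<close> only weakens \<open>hit\<close>; a large \<open>C\<close> makes the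
  relaxation times short.\<close>

locale attachment =
  fixes m :: nat and C c :: real and P :: "nat \<Rightarrow> 'g pmf" and K :: "nat \<Rightarrow> 'g \<Rightarrow> 'g pmf"
    and A :: "'g \<Rightarrow> (nat \<times> nat) set" and d :: "'g \<Rightarrow> nat \<Rightarrow> nat"
  assumes m: "m \<ge> 2" and C: "C \<ge> 8" and c: "0 < c" "c \<le> 1"
    and chain: "s \<ge> 2 \<Longrightarrow> P (Suc s) = bind_pmf (P s) (K s)"
    and A: "s \<ge> 2 \<Longrightarrow> G \<in> set_pmf (P s) \<Longrightarrow> A G \<subseteq> {1..s} \<times> {1..s}"
    and att: "s \<ge> 2 \<Longrightarrow> G \<in> set_pmf (P s) \<Longrightarrow> G' \<in> set_pmf (K s G) \<Longrightarrow>
      attached m (Suc s) (A G) (d G) (A G') (d G')"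
    and hit: "s \<ge> 2 \<Longrightarrow> G \<in> set_pmf (P s) \<Longrightarrow> T \<subseteq> {1..s} \<Longrightarrow> (\<And>u. u \<in> T \<Longrightarrow> d G u \<le> 3 * m) \<Longrightarrow>
      measure_pmf.prob (K s G) {G'. A G' `` {Suc s} \<inter> T \<noteq> {}} \<le> C * real (card T) / real s"
    and cover: "s \<ge> 2 \<Longrightarrow> G \<in> set_pmf (P s) \<Longrightarrow> U \<subseteq> {1..s} \<Longrightarrow>
      (c * real (card U) / real s) ^ m \<le> measure_pmf.prob (K s G) {G'. A G' `` {Suc s} \<subseteq> U}"
begin

section \<open>Change of the number of good vertices in one step\<close>

definition goods :: "nat \<Rightarrow> nat \<Rightarrow> 'g \<Rightarrow> nat set" where
  "goods s k G = {v \<in> {1..s}. good m (A G) (d G) k v}"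

definition Z :: "nat \<Rightarrow> nat \<Rightarrow> 'g \<Rightarrow> real" where
  "Z s k G = real (card (goods s k G))"

lemma finite_goods [simp]: "finite (goods s k G)"
  by (simp add: goods_def)

lemma Z_bounds: "0 \<le> Z s k G" "Z s k G \<le> real s"
proof -
  have "card (goods s k G) \<le> card {1..s}" by (intro card_mono) (auto simp: goods_def)
  then show "0 \<le> Z s k G" "Z s k G \<le> real s" by (auto simp: Z_def)
qed

context
  fixes s G G' assumes s: "s \<ge> 2" and G: "G \<in> set_pmf (P s)" and G': "G' \<in> set_pmf (K s G)"
begin

lemma A': "A G \<subseteq> {1..<Suc s} \<times> {1..<Suc s}"
  using A[OF s G] by (simp add: atLeastLessThanSuc_atLeastAtMost)

lemma goods_Suc_subset: "goods (Suc s) k G' \<subseteq> insert (Suc s) (goods s k G)"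
proof
  fix v assume v: "v \<in> goods (Suc s) k G'"
  show "v \<in> insert (Suc s) (goods s k G)"
  proof (cases "v = Suc s")
    case False
    with v have v1: "v \<in> {1..<Suc s}" by (auto simp: goods_def)
    then show ?thesis
      using good_attached_rev[OF att[OF s G G'] A' v1, of k] v by (auto simp: goods_def)
  qed simp
qed

lemma goods_Suc_superset:
  "{v \<in> goods s k G. A G' `` {Suc s} \<inter> tree (A G) k v = {}} \<subseteq> goods (Suc s) k G'"
  using good_attached_old[OF att[OF s G G'] A'] by (auto simp: goods_def)

lemma goods_Suc_new:
  assumes "k = 0 \<or> A G' `` {Suc s} \<subseteq> goods s (k - 1) G"
  shows "Suc s \<in> goods (Suc s) k G'"
  using good_attached_new[OF att[OF s G G'] A', of k] assms
  by (auto simp: goods_def atLeastLessThanSuc_atLeastAtMost)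

lemma Z_Suc_ge:
  "Z s k G - (\<Sum>v\<in>goods s k G. of_bool (A G' `` {Suc s} \<inter> tree (A G) k v \<noteq> {}))
     + of_bool (k = 0 \<or> A G' `` {Suc s} \<subseteq> goods s (k - 1) G) \<le> Z (Suc s) k G'"
proof -
  let ?hit = "{v \<in> goods s k G. A G' `` {Suc s} \<inter> tree (A G) k v \<noteq> {}}"
    and ?ok = "{v \<in> goods s k G. A G' `` {Suc s} \<inter> tree (A G) k v = {}}"
    and ?new = "if k = 0 \<or> A G' `` {Suc s} \<subseteq> goods s (k - 1) G then {Suc s} else {}"
  have "goods s k G = ?hit \<union> ?ok" "?hit \<inter> ?ok = {}" by auto
  then have "card (goods s k G) = card ?hit + card ?ok"
    by (metis (no_types, lifting) card_Un_disjoint finite_Un finite_goods)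
  moreover have "card ?ok + card ?new \<le> card (goods (Suc s) k G')"
  proof -
    have "card ?ok + card ?new = card (?ok \<union> ?new)"
      by (intro card_Un_disjoint[symmetric]) (auto simp: goods_def)
    also have "\<dots> \<le> card (goods (Suc s) k G')"
      using goods_Suc_superset goods_Suc_new[of k] by (intro card_mono) auto
    finally show ?thesis .
  qed
  ultimately have "real (card (goods s k G)) - real (card ?hit) + real (card ?new) \<le> Z (Suc s) k G'"
    unfolding Z_def by linarith
  moreover have "(\<Sum>v\<in>goods s k G. of_bool (A G' `` {Suc s} \<inter> tree (A G) k v \<noteq> {})) = real (card ?hit)"
    by (simp add: of_bool_def sum.If_cases Int_def)
  moreover have "real (card ?new) = of_bool (k = 0 \<or> A G' `` {Suc s} \<subseteq> goods s (k - 1) G)" by simp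
  ultimately show ?thesis by (simp add: Z_def)
qed

text \<open>Only the new vertex can be gained. Each of the at most \<open>m\<close> chosen vertices
  lies in at most one tree and so spoils at most one good vertex.\<close>

lemma Z_Suc_diff: "\<bar>Z (Suc s) k G' - Z s k G\<bar> \<le> real m"
proof -
  let ?B = "A G' `` {Suc s}"
  let ?hit = "{v \<in> goods s k G. ?B \<inter> tree (A G) k v \<noteq> {}}"
  have B: "finite ?B" "card ?B \<le> m"
    using att[OF s G G'] unfolding attached_def by (auto intro: finite_subset)
  have "card (goods (Suc s) k G') \<le> Suc (card (goods s k G))"
    using card_mono[OF _ goods_Suc_subset[of k]] by (simp add: card_insert_if split: if_splits)
  then have up: "Z (Suc s) k G' - Z s k G \<le> 1" by (simp add: Z_def)
  have "goods s k G \<subseteq> ?hit \<union> goods (Suc s) k G'"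
    using goods_Suc_superset[of k] by auto
  then have "card (goods s k G) \<le> card (?hit \<union> goods (Suc s) k G')"
    by (intro card_mono) auto
  also have "\<dots> \<le> card ?hit + card (goods (Suc s) k G')" by (rule card_Un_le)
  also have "card ?hit \<le> m"
  proof -
    have one: "card {v \<in> goods s k G. b \<in> tree (A G) k v} \<le> 1" for b
    proof (rule card_le_Suc0_iff_eq[THEN iffD2, unfolded One_nat_def[symmetric]])
      show "\<forall>x\<in>{v \<in> goods s k G. b \<in> tree (A G) k v}. \<forall>y\<in>{v \<in> goods s k G. b \<in> tree (A G) k v}. x = y"
        using good_levels_inj by (fastforce simp: goods_def tree_def)
    qed simp
    have "card ?hit \<le> card (\<Union>b\<in>?B. {v \<in> goods s k G. b \<in> tree (A G) k v})"
      using B by (intro card_mono) auto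
    also have "\<dots> \<le> (\<Sum>b\<in>?B. card {v \<in> goods s k G. b \<in> tree (A G) k v})"
      by (rule card_UN_le) (rule B)
    also have "\<dots> \<le> (\<Sum>b\<in>?B. 1)" by (rule sum_mono) (rule one)
    also have "\<dots> \<le> m" using B by simp
    finally show ?thesis .
  qed
  finally have "Z s k G - Z (Suc s) k G' \<le> real m" by (simp add: Z_def)
  then show ?thesis using up m by linarith
qed

end

text \<open>Expectation of \<open>Z_Suc_ge\<close>. For each good vertex \<open>hit\<close> applies
  to its tree, which has at most \<open>m ^ Suc k\<close> vertices, all of degree at most
  \<open>3 * m\<close>; for \<open>k > 0\<close>, \<open>cover\<close> applies to the good vertices
  of depth \<open>k - 1\<close>.\<close>

lemma expectation_Z_Suc:
  assumes s: "s \<ge> 2" and G: "G \<in> set_pmf (P s)"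
  shows "(1 - C * real (m ^ Suc k) / real s) * Z s k G
      + (case k of 0 \<Rightarrow> 1 | Suc l \<Rightarrow> (c * Z s l G / real s) ^ m)
    \<le> measure_pmf.expectation (K s G) (Z (Suc s) k)"
proof -
  let ?hit = "\<lambda>v. {G'. A G' `` {Suc s} \<inter> tree (A G) k v \<noteq> {}}"
    and ?new = "{G'. k = 0 \<or> A G' `` {Suc s} \<subseteq> goods s (k - 1) G}"
  let ?f = "\<lambda>G'. Z s k G - (\<Sum>v\<in>goods s k G. indicator (?hit v) G') + indicator ?new G' :: real"
  have int: "integrable (measure_pmf (K s G)) (indicator X :: 'g \<Rightarrow> real)" for X
    by (intro integrable_real_indicator) (simp_all add: less_top[symmetric])
  have int_sum: "integrable (measure_pmf (K s G)) (\<lambda>G'. \<Sum>v\<in>goods s k G. indicator (?hit v) G' :: real)"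
    by (intro Bochner_Integration.integrable_sum int)
  have "measure_pmf.expectation (K s G) ?f \<le> measure_pmf.expectation (K s G) (Z (Suc s) k)"
  proof (rule integral_mono_AE)
    show "integrable (measure_pmf (K s G)) (Z (Suc s) k)"
      using Z_bounds[of "Suc s" k]
      by (intro measure_pmf.integrable_const_bound[where B = "real (Suc s)"] AE_I2) (auto simp del: of_nat_Suc)
    show "AE G' in measure_pmf (K s G). ?f G' \<le> Z (Suc s) k G'"
      unfolding AE_measure_pmf_iff
      using Z_Suc_ge[OF s G, of _ k] by (auto simp: indicator_def of_bool_def)
  qed (use int int_sum in simp)
  moreover have "measure_pmf.expectation (K s G) ?f =
      Z s k G - (\<Sum>v\<in>goods s k G. measure_pmf.prob (K s G) (?hit v)) + measure_pmf.prob (K s G) ?new"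
  proof -
    have "measure_pmf.expectation (K s G) ?f =
        measure_pmf.expectation (K s G) (\<lambda>G'. Z s k G - (\<Sum>v\<in>goods s k G. indicator (?hit v) G')) +
        measure_pmf.prob (K s G) ?new"
      using int int_sum by (subst Bochner_Integration.integral_add) auto
    also have "measure_pmf.expectation (K s G) (\<lambda>G'. Z s k G - (\<Sum>v\<in>goods s k G. indicator (?hit v) G')) =
        Z s k G - measure_pmf.expectation (K s G) (\<lambda>G'. \<Sum>v\<in>goods s k G. indicator (?hit v) G')"
      using int_sum by (subst Bochner_Integration.integral_diff) (auto simp: measure_pmf.prob_space)
    also have "measure_pmf.expectation (K s G) (\<lambda>G'. \<Sum>v\<in>goods s k G. indicator (?hit v) G' :: real) =
        (\<Sum>v\<in>goods s k G. measure_pmf.prob (K s G) (?hit v))"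
      by (subst Bochner_Integration.integral_sum) (auto intro: int)
    finally show ?thesis .
  qed
  moreover have "(\<Sum>v\<in>goods s k G. measure_pmf.prob (K s G) (?hit v)) \<le>
      (\<Sum>v\<in>goods s k G. C * real (m ^ Suc k) / real s)"
  proof (rule sum_mono)
    fix v assume v: "v \<in> goods s k G"
    have fin: "finite (A G)" using A[OF s G] by (rule finite_subset) simp
    have good: "good m (A G) (d G) k v" "v \<in> {1..s}" using v by (auto simp: goods_def)
    have "tree (A G) k v \<subseteq> {1..s}"
      using level_subset[OF A[OF s G] good(2)] by (auto simp: tree_def)
    moreover have "d G u \<le> 3 * m" if "u \<in> tree (A G) k v" for u
      using good(1) that by (auto simp: tree_def good_def)
    ultimately have "measure_pmf.prob (K s G) (?hit v) \<le> C * real (card (tree (A G) k v)) / real s"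
      by (intro hit[OF s G])
    also have "\<dots> \<le> C * real (m ^ Suc k) / real s"
      using card_tree_le[OF fin good(1) m] C
      by (intro divide_right_mono mult_left_mono of_nat_mono) auto
    finally show "measure_pmf.prob (K s G) (?hit v) \<le> C * real (m ^ Suc k) / real s" .
  qed
  moreover have "(case k of 0 \<Rightarrow> 1 | Suc l \<Rightarrow> (c * Z s l G / real s) ^ m) \<le> measure_pmf.prob (K s G) ?new"
  proof (cases k)
    case (Suc l)
    have "goods s l G \<subseteq> {1..s}" by (auto simp: goods_def)
    from cover[OF s G this] show ?thesis by (simp add: Suc Z_def)
  qed simp
  ultimately show ?thesis by (simp add: Z_def algebra_simps)
qed

section \<open>Comparison with the profile between the times \<open>t div 2\<close> and
  \<open>t\<close>\<close>

context
  fixes t k :: nat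
  assumes t: "t \<ge> 4" and k: "3 * C * real (m ^ Suc k) \<le> real t"
begin

text \<open>All times \<open>s\<close> considered satisfy \<open>t \<le> 3 * s\<close> and
  \<open>s \<le> t\<close>. So \<open>rate\<close> bounds the loss rate from above and
  \<open>gain\<close> the success probability from below, with coefficients independent of
  \<open>s\<close>.\<close>

definition rate :: "nat \<Rightarrow> real" where
  "rate j = 3 * C * real (m ^ Suc j) / real t"

definition gain :: "real \<Rightarrow> real" where
  "gain x = (c * x / real t) ^ m"

definition target :: "nat \<Rightarrow> nat \<Rightarrow> real" where
  "target n j = profile rate gain n j"

definition deficit :: "nat \<Rightarrow> nat \<Rightarrow> 'g \<Rightarrow> real" where
  "deficit j n G = max 0 (target n j - Z (t div 2 + n) j G)"

definition err :: "nat \<Rightarrow> nat \<Rightarrow> real" where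
  "err j n = measure_pmf.expectation (P (t div 2 + n)) (\<lambda>G. (deficit j n G)\<^sup>2)"

lemma rate: "0 < rate j" "j \<le> k \<Longrightarrow> rate j \<le> 1"
proof -
  show "0 < rate j" using m C t by (simp add: rate_def)
  assume "j \<le> k"
  then have "real (m ^ Suc j) \<le> real (m ^ Suc k)" using m by (intro of_nat_mono power_increasing) auto
  then have "3 * C * real (m ^ Suc j) \<le> 3 * C * real (m ^ Suc k)"
    using C by (intro mult_left_mono) auto
  also note k
  finally show "rate j \<le> 1" using t by (simp add: rate_def)
qed

lemma gain_bounds:
  assumes "0 \<le> x" "x \<le> y" "y \<le> real t"
  shows "0 \<le> gain x \<and> gain x \<le> gain y \<and> gain y \<le> 1"
proof -
  have "c * x \<le> c * y" using assms c by simp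
  moreover have "c * y \<le> 1 * real t" using assms c by (intro mult_mono) auto
  ultimately show ?thesis
    using assms c t unfolding gain_def
    by (intro conjI zero_le_power power_mono power_le_one divide_right_mono) auto
qed

text \<open>The power \<open>x ^ m\<close> has Lipschitz constant \<open>m\<close> on the unit
  interval, and \<open>c \<le> 1\<close>; for \<open>y > x\<close> the left side is 0 by
  monotonicity.\<close>

lemma gain_lipschitz:
  assumes "0 \<le> x" "x \<le> real t" "0 \<le> y"
  shows "max 0 (gain x - gain y) \<le> real m / real t * max 0 (x - y)"
proof (cases "y \<le> x")
  case True
  let ?x = "c * x / real t" and ?y = "c * y / real t"
  have "c * x \<le> 1 * real t" using assms c by (intro mult_mono) auto
  then have xy: "0 \<le> ?y" "?y \<le> ?x" "?x \<le> 1"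
    using assms c t True by (auto simp: divide_right_mono)
  have "?x ^ m - ?y ^ m = (?x - ?y) * (\<Sum>i<m. ?y ^ (m - Suc i) * ?x ^ i)"
    by (rule power_diff_sumr2)
  also have "\<dots> \<le> (?x - ?y) * (\<Sum>i<m. 1)"
    using xy by (intro mult_left_mono sum_mono mult_le_one power_le_one zero_le_power) auto
  also have "\<dots> = real m / real t * (c * (x - y))"
    by (simp add: diff_divide_distrib algebra_simps)
  also have "\<dots> \<le> real m / real t * (1 * (x - y))"
    using c True t by (intro mult_left_mono mult_right_mono) auto
  finally show ?thesis using True t by (simp add: gain_def)
next
  case False
  then have "c * x / real t \<le> c * y / real t" using c by (intro divide_right_mono mult_left_mono) auto
  then have "gain x \<le> gain y" unfolding gain_def using assms c by (intro power_mono) auto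
  then show ?thesis by simp
qed

lemma target:
  assumes "real n \<le> real t" "j \<le> k"
  shows "0 \<le> target n j" "target n j \<le> real n"
  using profile_bounds[of k rate "real t" gain n j] rate gain_bounds assms
  by (auto simp: target_def less_imp_le)

lemma target_step:
  assumes "real (Suc n) \<le> real t" "j \<le> k"
  shows "target n j \<le> target (Suc n) j" "target (Suc n) j \<le> target n j + 1"
  using profile_step[of k rate "real t" gain n j] rate gain_bounds assms
  by (auto simp: target_def less_imp_le)

lemma deficit_bounds:
  assumes "n \<le> t" "j \<le> k"
  shows "0 \<le> deficit j n G" "deficit j n G \<le> real t"
  using target[of n j] Z_bounds[of "t div 2 + n" j G] assms by (auto simp: deficit_def)

text \<open>This is \<open>deficit_square_step\<close> for \<open>Z\<close> and
  \<open>target\<close>; by \<open>gain_lipschitz\<close> the gain falls short by at most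
  \<open>m / t\<close> times the deficit one depth below.\<close>

lemma deficit_step:
  assumes n: "t div 2 + n < t" and j: "j \<le> k" and G: "G \<in> set_pmf (P (t div 2 + n))"
  shows "measure_pmf.expectation (K (t div 2 + n) G) (\<lambda>G'. (deficit j (Suc n) G')\<^sup>2) \<le>
    (1 + real m / real t) * (deficit j n G)\<^sup>2 +
    (case j of 0 \<Rightarrow> 0 | Suc i \<Rightarrow> real m / real t * (deficit i n G)\<^sup>2) + (real m + 1)\<^sup>2"
proof -
  let ?s = "t div 2 + n"
  have s: "?s \<ge> 2" using t by simp
  \<comment> \<open>The factor 2 would fail for odd \<open>t\<close>, as \<open>t div 2\<close>
    rounds down.\<close>
  have st: "real t \<le> 3 * real ?s" "real ?s \<le> real t" 
  proof -
    have "t \<le> 3 * (t div 2)" using t by presburger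
    then have "t \<le> 3 * ?s" by simp
    moreover have "?s \<le> t" using n by linarith
    ultimately show "real t \<le> 3 * real ?s" "real ?s \<le> real t" by (simp_all flip: of_nat_mult)
  qed
  let ?b = "case j of 0 \<Rightarrow> 1 | Suc i \<Rightarrow> gain (Z ?s i G)"
    and ?ideal = "case j of 0 \<Rightarrow> 1 | Suc i \<Rightarrow> gain (target n i)"
  have drift: "(1 - rate j) * Z ?s j G + ?b \<le> measure_pmf.expectation (K ?s G) (Z (Suc ?s) j)"
  proof (rule order_trans[OF add_mono expectation_Z_Suc[OF s G]])
    have "C * real (m ^ Suc j) / real ?s \<le> rate j"
      using st C s mult_left_mono[OF st(1), of "C * real (m ^ Suc j)"]
      unfolding rate_def by (simp add: field_simps)
    then show "(1 - rate j) * Z ?s j G \<le> (1 - C * real (m ^ Suc j) / real ?s) * Z ?s j G"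
      using Z_bounds by (intro mult_right_mono) auto
    have "gain (Z ?s i G) \<le> (c * Z ?s i G / real ?s) ^ m" for i
      unfolding gain_def using c Z_bounds(1) st s
      by (intro power_mono divide_left_mono mult_nonneg_nonneg divide_nonneg_nonneg) auto
    then show "?b \<le> (case j of 0 \<Rightarrow> 1 | Suc l \<Rightarrow> (c * Z ?s l G / real ?s) ^ m)"
      by (simp split: nat.split)
  qed
  have "measure_pmf.expectation (K ?s G) (\<lambda>G'. (max 0 (target (Suc n) j - Z (Suc ?s) j G'))\<^sup>2) \<le>
      (max 0 (target n j - Z ?s j G))\<^sup>2 + 2 * max 0 (target n j - Z ?s j G) * max 0 (?ideal - ?b) + (real m + 1)\<^sup>2"
  proof (rule deficit_square_step[OF _ _ _ _ _ _ drift])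
    show "\<bar>Z (Suc ?s) j G'\<bar> \<le> real (Suc ?s)" for G' using Z_bounds[of "Suc ?s" j G'] by simp
    show "\<bar>Z (Suc ?s) j G' - Z ?s j G\<bar> \<le> real m" if "G' \<in> set_pmf (K ?s G)" for G'
      by (rule Z_Suc_diff[OF s G that])
    show "target n j \<le> target (Suc n) j" "target (Suc n) j \<le> target n j + 1"
      using target_step[of n j] n j by auto
    show "target (Suc n) j = (1 - rate j) * target n j + ?ideal"
      by (simp add: target_def split: nat.split)
  qed (use rate(1) in \<open>simp add: less_imp_le\<close>)
  then have step: "measure_pmf.expectation (K ?s G) (\<lambda>G'. (deficit j (Suc n) G')\<^sup>2) \<le>
      (deficit j n G)\<^sup>2 + 2 * deficit j n G * max 0 (?ideal - ?b) + (real m + 1)\<^sup>2"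
    by (simp add: deficit_def)
  have D: "0 \<le> deficit j n G" by (simp add: deficit_def)
  show ?thesis
  proof (cases j)
    case 0
    have "1 * (deficit 0 n G)\<^sup>2 \<le> (1 + real m / real t) * (deficit 0 n G)\<^sup>2"
      by (intro mult_right_mono) auto
    then show ?thesis using step 0 by simp
  next
    case (Suc i)
    have "max 0 (?ideal - ?b) \<le> real m / real t * deficit i n G"
      using gain_lipschitz[of "target n i" "Z ?s i G"] target[of n i] Z_bounds(1)[of ?s i G] n j Suc
      by (simp add: deficit_def)
    then have "2 * deficit j n G * max 0 (?ideal - ?b) \<le> 2 * deficit j n G * (real m / real t * deficit i n G)"
      using D by (intro mult_left_mono) auto
    also have "\<dots> = real m / real t * (2 * deficit j n G * deficit i n G)" by simp
    \<comment> \<open>The inequality \<open>2 * a * b \<le> a ^ 2 + b ^ 2\<close> decouples the two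
      deficits, which makes the recursion linear in the second moments.\<close>
    also have "\<dots> \<le> real m / real t * ((deficit j n G)\<^sup>2 + (deficit i n G)\<^sup>2)"
      using sum_squares_bound[of "deficit j n G" "deficit i n G"] by (intro mult_left_mono) auto
    finally show ?thesis using step Suc by (simp add: algebra_simps)
  qed
qed

lemma integrable_deficit:
  assumes "n \<le> t" "j \<le> k"
  shows "integrable (measure_pmf p) (\<lambda>G. (deficit j n G)\<^sup>2)"
proof (rule measure_pmf.integrable_const_bound[where B = "(real t)\<^sup>2"])
  show "AE G in measure_pmf p. norm ((deficit j n G)\<^sup>2) \<le> (real t)\<^sup>2"
    using deficit_bounds[OF assms] by (intro AE_I2) (auto intro!: power_mono)
qed simp

lemma err_step:
  assumes n: "t div 2 + n < t" and j: "j \<le> k"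
  shows "err j (Suc n) \<le> (1 + real m / real t) * err j n +
    (case j of 0 \<Rightarrow> 0 | Suc i \<Rightarrow> real m / real t * err i n) + (real m + 1)\<^sup>2"
proof -
  let ?s = "t div 2 + n"
  have nt: "n \<le> t" "Suc n \<le> t" using n by auto
  let ?f = "\<lambda>G. (1 + real m / real t) * (deficit j n G)\<^sup>2 +
    (case j of 0 \<Rightarrow> 0 | Suc i \<Rightarrow> real m / real t * (deficit i n G)\<^sup>2) + (real m + 1)\<^sup>2"
  have int: "integrable (measure_pmf (P ?s)) (\<lambda>G. (deficit j n G)\<^sup>2)"
    by (rule integrable_deficit[OF nt(1) j])
  have int2: "integrable (measure_pmf (P ?s)) (\<lambda>G. (deficit i n G)\<^sup>2)" if "j = Suc i" for i
    using that j by (intro integrable_deficit[OF nt(1)]) auto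
  have "P (t div 2 + Suc n) = bind_pmf (P ?s) (K ?s)"
    using chain[of ?s] t by simp
  then have "err j (Suc n) = measure_pmf.expectation (bind_pmf (P ?s) (K ?s)) (\<lambda>G. (deficit j (Suc n) G)\<^sup>2)"
    by (simp add: err_def)
  also have "\<dots> = measure_pmf.expectation (P ?s)
      (\<lambda>G. measure_pmf.expectation (K ?s G) (\<lambda>G'. (deficit j (Suc n) G')\<^sup>2))"
    using deficit_bounds[OF nt(2) j] by (intro expectation_bind_pmf[where b = "(real t)\<^sup>2"]) (auto intro!: power_mono)
  also have "\<dots> \<le> measure_pmf.expectation (P ?s) ?f"
  proof (rule integral_mono_AE)
    have b: "0 \<le> measure_pmf.expectation (K ?s G) (\<lambda>G'. (deficit j (Suc n) G')\<^sup>2)" for G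
      by (intro integral_nonneg_AE) auto
    have b': "measure_pmf.expectation (K ?s G) (\<lambda>G'. (deficit j (Suc n) G')\<^sup>2) \<le> (real t)\<^sup>2" for G
      using deficit_bounds[OF nt(2) j]
      by (intro measure_pmf.integral_le_const integrable_deficit nt j AE_I2) (auto intro!: power_mono)
    show "integrable (measure_pmf (P ?s)) (\<lambda>G. measure_pmf.expectation (K ?s G) (\<lambda>G'. (deficit j (Suc n) G')\<^sup>2))"
      using b b' by (intro measure_pmf.integrable_const_bound[where B = "(real t)\<^sup>2"]) auto
    show "integrable (measure_pmf (P ?s)) ?f"
      using int int2 by (cases j) auto
    show "AE G in measure_pmf (P ?s). measure_pmf.expectation (K ?s G) (\<lambda>G'. (deficit j (Suc n) G')\<^sup>2) \<le> ?f G"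
      unfolding AE_measure_pmf_iff using deficit_step[OF n j] by blast
  qed
  also have "\<dots> = (1 + real m / real t) * err j n +
      (case j of 0 \<Rightarrow> 0 | Suc i \<Rightarrow> real m / real t * err i n) + (real m + 1)\<^sup>2"
    using int int2 by (cases j) (auto simp: err_def measure_pmf.prob_space)
  finally show ?thesis .
qed

lemma err_bound:
  assumes "j \<le> k" "t div 2 + n \<le> t"
  shows "err j n \<le> (exp (real m) * (real m + 1) * (real m + 1)\<^sup>2) ^ Suc j * real t"
proof (rule coupled_recurrence_bound[where k = k and N = "t - t div 2"])
  \<comment> \<open>The profile starts at 0, so there is no initial deficit, whatever the state at
    time \<open>t div 2\<close>.\<close>
  show "err j 0 \<le> 0" for j
  proof -
    have "deficit j 0 G = 0" for G using Z_bounds(1) by (simp add: deficit_def target_def)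
    then show ?thesis by (simp add: err_def)
  qed
  show "err 0 (Suc n) \<le> (1 + real m / real t) * err 0 n + (real m + 1)\<^sup>2" if "n < t - t div 2" for n
    using err_step[of n 0] that by simp
  show "err (Suc j) (Suc n) \<le> (1 + real m / real t) * err (Suc j) n + (real m / real t * err j n + (real m + 1)\<^sup>2)"
    if "j < k" "n < t - t div 2" for j n
    using err_step[of n "Suc j"] that by (simp add: add.assoc)
  show "1 \<le> (real m + 1)\<^sup>2" by (simp add: one_le_power)
qed (use t assms in auto)

text \<open>Chebyshev's inequality: without good vertices the deficit is the whole target, hence at
  least \<open>x\<close>.\<close>

lemma prob_no_good_le:
  assumes "0 < x" "x \<le> target (t - t div 2) k"
  shows "measure_pmf.prob (P t) {G. goods t k G = {}} \<le>
    (exp (real m) * (real m + 1) * (real m + 1)\<^sup>2) ^ Suc k * real t / x\<^sup>2"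
proof -
  let ?n = "t - t div 2"
  have "x\<^sup>2 * measure_pmf.prob (P t) {G. goods t k G = {}} =
      measure_pmf.expectation (P t) (\<lambda>G. x\<^sup>2 * indicator {G. goods t k G = {}} G)" by simp
  also have "\<dots> \<le> measure_pmf.expectation (P t) (\<lambda>G. (deficit k ?n G)\<^sup>2)"
  proof (rule integral_mono_AE)
    show "AE G in measure_pmf (P t). x\<^sup>2 * indicator {G. goods t k G = {}} G \<le> (deficit k ?n G)\<^sup>2"
    proof (rule AE_I2)
      fix G
      have "x\<^sup>2 \<le> (deficit k ?n G)\<^sup>2" if "goods t k G = {}"
        using assms that by (intro power_mono) (auto simp: deficit_def Z_def)
      then show "x\<^sup>2 * indicator {G. goods t k G = {}} G \<le> (deficit k ?n G)\<^sup>2"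
        by (auto simp: indicator_def)
    qed
  qed (auto intro: integrable_deficit simp: less_top[symmetric] intro!: integrable_mult_right integrable_real_indicator simp del: integrable_mult_right_iff)
  also have "\<dots> = err k ?n" by (simp add: err_def)
  also have "\<dots> \<le> (exp (real m) * (real m + 1) * (real m + 1)\<^sup>2) ^ Suc k * real t"
    by (rule err_bound) auto
  finally show ?thesis using assms by (simp add: field_simps)
qed

end

section \<open>Lower bounds for the profile\<close>

text \<open>\<open>real t * density j\<close> is half the fixed point \<open>b / rate\<close> of the
  recursion at depth \<open>j\<close>, where \<open>b\<close> is 1 for \<open>j = 0\<close> and
  otherwise the gain at \<open>real t * density (j - 1)\<close>; the half is the loss in
  \<open>relaxation_bound\<close>.\<close>

primrec density :: "nat \<Rightarrow> real" where
  "density 0 = 1 / (6 * C * real m)"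
| "density (Suc j) = (c * density j) ^ m / (6 * C * real (m ^ Suc (Suc j)))"

lemma density_pos: "0 < density j"
  using m C c by (induction j) auto

text \<open>Depth \<open>j\<close> is given the time \<open>t / 2 ^ (j + 3)\<close>, which exceeds the relaxation time \<open>1 / rate t j\<close>, after
  depth \<open>j - 1\<close> has reached its level.\<close>

lemma target_ge_density:
  assumes t: "t \<ge> 4" and k: "3 * C * real (m ^ Suc k) \<le> real t"
    and "j \<le> k" "n \<le> t" "real t / 4 * (1 - (1 / 2) ^ Suc j) \<le> real n"
  shows "real t * density j \<le> target t n j"
  using assms(3-5)
proof (induction j arbitrary: n)
  have relax: "b / (2 * rate t j) \<le> target t n j"
    if j: "j \<le> k" and n: "n \<le> t" "real t / 4 * (1 - (1 / 2) ^ Suc j) \<le> real n" and b: "0 \<le> b"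
      and step: "\<And>n. real t / 4 * (1 - (1 / 2) ^ j) \<le> real n \<Longrightarrow> n < t \<Longrightarrow>
        (1 - rate t j) * target t n j + b \<le> target t (Suc n) j"
    for j n b
  proof -
    let ?n1 = "nat \<lceil>real t / 4 * (1 - (1 / 2) ^ j)\<rceil>"
    have p: "(1 / 2 :: real) ^ j \<le> 1" by (simp add: power_le_one)
    then have n1: "real t / 4 * (1 - (1 / 2) ^ j) \<le> real ?n1"
        "real ?n1 \<le> real t / 4 * (1 - (1 / 2) ^ j) + 1"
      by (auto simp: of_nat_ceiling)
    \<comment> \<open>The time available is \<open>real t / 2 ^ (j + 3)\<close>; rounding the
      starting time up costs at most 1.\<close>
    have gap: "real t / 8 * (1 / 2) ^ j - 1 \<le> real n - real ?n1"
      using n(2) n1(2) by (simp add: algebra_simps)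
    have r: "0 < rate t j" "rate t j \<le> 1" using rate[OF t k] j by auto
    \<comment> \<open>As \<open>m \<ge> 2\<close>, the growth of the rate with the depth makes up
      for the halving of the available time. The bound aimed at is 2 instead of 1, which leaves room
      for the rounding since \<open>rate t j \<le> 1\<close>.\<close>
    have "(2::real) ^ Suc j \<le> real m ^ Suc j" using m by (intro power_mono) auto
    then have "2 * 1 \<le> (real m / 2) ^ Suc j * 2" by (simp add: power_divide field_simps)
    also have "\<dots> \<le> (real m / 2) ^ Suc j * (3 * C / 4)" using C by (intro mult_left_mono) auto
    also have "\<dots> = rate t j * (real t / 8 * (1 / 2) ^ j)"
      using t by (simp add: rate_def[OF t k] power_divide)
    finally have two: "2 \<le> rate t j * (real t / 8 * (1 / 2) ^ j)" by simp
    have "1 \<le> rate t j * (real t / 8 * (1 / 2) ^ j - 1)" using two r by (simp add: right_diff_distrib)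
    also have "\<dots> \<le> rate t j * (real n - real ?n1)" using gap r by (intro mult_left_mono) auto
    finally have rn: "1 \<le> rate t j * (real n - real ?n1)" .
    then have "0 < real n - real ?n1" using r by (smt (verit) mult_nonneg_nonpos)
    then have n1n: "?n1 \<le> n" by linarith
    show ?thesis
    proof (rule relaxation_bound[where N = n and ?n1.0 = ?n1 and a = "\<lambda>l. target t l j"])
      show "0 \<le> target t ?n1 j" using target(1)[OF t k, of ?n1 j] j n n1n by simp
      show "(1 - rate t j) * target t l j + b \<le> target t (Suc l) j" if "?n1 \<le> l" "l < n" for l
        using step[of l] that n1 n by simp
    qed (use r b n1n rn in auto)
  qed
  {
    case 0
    have "real t * density 0 = 1 / (2 * rate t 0)" using t C m by (simp add: rate_def[OF t k])
    also have "\<dots> \<le> target t n 0"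
      by (rule relax) (use 0 in \<open>auto simp: target_def[OF t k]\<close>)
    finally show ?case .
  next
    case (Suc i)
    let ?b = "(c * density i) ^ m"
    have "real t * density (Suc i) = ?b / (2 * rate t (Suc i))"
      using t C m by (simp add: rate_def[OF t k] mult_ac)
    also have "\<dots> \<le> target t n (Suc i)"
    proof (rule relax)
      fix l assume l: "real t / 4 * (1 - (1 / 2) ^ Suc i) \<le> real l" "l < t"
      have "real t * density i \<le> target t l i" using Suc l by simp
      then have "c * density i \<le> c * target t l i / real t"
        using c t by (simp add: field_simps mult_left_mono)
      then have "?b \<le> gain t (target t l i)"
        unfolding gain_def[OF t k] using c density_pos[of i] by (intro power_mono) auto
      then show "(1 - rate t (Suc i)) * target t l (Suc i) + ?b \<le> target t (Suc l) (Suc i)"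
        by (simp add: target_def[OF t k])
    qed (use Suc c density_pos[of i] in \<open>auto intro!: zero_le_power\<close>)
    finally show ?case .
  }
qed

text \<open>The subtracted term \<open>2 * j + 4\<close> absorbs the factors \<open>m ^ (j + 2)\<close> in the recursion of \<open>density\<close>.\<close>

lemma ln_density_ge:
  defines "R \<equiv> real m * ln (1 / c) + ln (6 * C) + ln (real m)"
  shows "- (R * (5 * real m ^ j - real (2 * j + 4))) \<le> ln (density j)"
proof (induction j)
  case 0
  have "0 \<le> real m * ln (1 / c)" using c by simp
  \<comment> \<open>At \<open>j = 0\<close> the factor of \<open>R\<close> is
    \<open>5 - 4 = 1\<close>, which explains the constant 5.\<close>
  then show ?case using m C by (simp add: R_def ln_div ln_mult)
next
  case (Suc j)
  have nonneg: "0 \<le> real m * ln (1 / c)" "0 \<le> ln (6 * C)" "0 \<le> ln (real m)"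
    using m C c by auto
  have "real m * ln (1 / c) + ln (6 * C) + real (j + 2) * ln (real m) \<le>
      real (j + 2) * (real m * ln (1 / c)) + real (j + 2) * ln (6 * C) + real (j + 2) * ln (real m)"
    using nonneg by (intro add_mono) (auto simp: mult_le_cancel_right1)
  also have "\<dots> = real (j + 2) * R" by (simp add: R_def algebra_simps)
  finally have loss: "real m * ln (1 / c) + ln (6 * C) + real (j + 2) * ln (real m) \<le> real (j + 2) * R" .
  have "ln (density (Suc j)) = real m * ln (density j)
      - (real m * ln (1 / c) + ln (6 * C) + real (j + 2) * ln (real m))"
    using m C c density_pos[of j]
    by (simp add: ln_div ln_mult ln_realpow algebra_simps)
  moreover have "real m * (- (R * (5 * real m ^ j - real (2 * j + 4)))) \<le> real m * ln (density j)"
    using Suc by (intro mult_left_mono) auto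
  ultimately have "ln (density (Suc j)) \<ge>
      - (R * (5 * real m ^ Suc j)) + R * (real m * real (2 * j + 4) - real (j + 2))"
    using loss by (simp add: algebra_simps)
  \<comment> \<open>For \<open>m \<ge> 2\<close> the right factor is at least
    \<open>3 * j + 6\<close>, and \<open>2 * j + 6\<close> is required.\<close>
  moreover have "R * real (2 * Suc j + 4) \<le> R * (real m * real (2 * j + 4) - real (j + 2))"
  proof (rule mult_left_mono)
    have "2 * real (2 * j + 4) \<le> real m * real (2 * j + 4)" using m by (intro mult_right_mono) auto
    then show "real (2 * Suc j + 4) \<le> real m * real (2 * j + 4) - real (j + 2)" by simp
  qed (use nonneg in \<open>simp add: R_def\<close>)
  ultimately show ?case by (simp add: algebra_simps)
qed

lemma density_ge_exp:
  obtains R where "0 < R" "\<And>j. exp (- (R * real m ^ j)) \<le> density j"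
proof -
  let ?R = "real m * ln (1 / c) + ln (6 * C) + ln (real m)"
  have R: "0 < ?R" using m C c by (intro add_nonneg_pos add_pos_pos mult_nonneg_nonneg) auto
  have "exp (- ((5 * ?R) * real m ^ j)) \<le> density j" for j
  proof -
    have "0 \<le> ?R * real (2 * j + 4)" using R by (intro mult_nonneg_nonneg) auto
    then have "- ((5 * ?R) * real m ^ j) \<le> - (?R * (5 * real m ^ j - real (2 * j + 4)))"
      by (simp add: algebra_simps)
    also note ln_density_ge
    finally show ?thesis using density_pos[of j] by (simp add: ln_ge_iff)
  qed
  then show ?thesis using that[of "5 * ?R"] R by auto
qed

section \<open>Good vertices with high probability\<close>

lemma prob_goods_ge:
  obtains q R where "0 < q" "0 < R"
    "\<And>t k. t \<ge> 4 \<Longrightarrow> 3 * C * real (m ^ Suc k) \<le> real t \<Longrightarrow>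
      measure_pmf.prob (P t) {G. goods t k G \<noteq> {}} \<ge> 1 - exp (q * real (Suc k) + R * real m ^ k - ln (real t))"
proof -
  define Q where "Q = exp (real m) * (real m + 1) * (real m + 1)\<^sup>2"
  obtain R where R: "0 < R" "\<And>j. exp (- (R * real m ^ j)) \<le> density j" using density_ge_exp by blast
  have "1 < real m + 1" "1 < exp (real m)" "1 < (real m + 1)\<^sup>2" using m by auto
  then have Q: "1 < Q" by (simp only: Q_def less_1_mult)
  have "measure_pmf.prob (P t) {G. goods t k G \<noteq> {}} \<ge>
      1 - exp (ln Q * real (Suc k) + 2 * R * real m ^ k - ln (real t))"
    if t: "t \<ge> 4" and k: "3 * C * real (m ^ Suc k) \<le> real t" for t k
  proof -
    \<comment> \<open>Every depth reaches its level within \<open>t / 4\<close> steps, and at least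
      \<open>t / 2\<close> are available.\<close>
    have n: "real t / 4 * (1 - (1 / 2) ^ Suc k) \<le> real (t - t div 2)"
    proof -
      have "t \<le> 2 * (t - t div 2)" by presburger
      then have "real t \<le> 2 * real (t - t div 2)" by (simp flip: of_nat_mult)
      moreover have "real t / 4 * (1 - (1 / 2) ^ Suc k) \<le> real t / 4 * 1"
        by (intro mult_left_mono) auto
      ultimately show ?thesis by simp
    qed
    have x: "0 < real t * density k" "real t * density k \<le> target t (t - t div 2) k"
      using t density_pos[of k] target_ge_density[OF t k order_refl _ n] by auto
    have dens: "exp (- (2 * R * real m ^ k)) \<le> (density k)\<^sup>2"
    proof -
      have "exp (- (2 * R * real m ^ k)) = (exp (- (R * real m ^ k)))\<^sup>2"
        by (simp add: power2_eq_square mult_exp_exp)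
      also have "\<dots> \<le> (density k)\<^sup>2" using R(2) by (intro power_mono) auto
      finally show ?thesis .
    qed
    \<comment> \<open>A factor \<open>1 / real t\<close> survives here; the square of the density
      turns \<open>R\<close> into \<open>2 * R\<close>.\<close>
    have "measure_pmf.prob (P t) {G. goods t k G = {}} \<le> Q ^ Suc k * real t / (real t * density k)\<^sup>2"
      by (rule prob_no_good_le[OF t k x, folded Q_def])
    also have "\<dots> = Q ^ Suc k / real t * (1 / (density k)\<^sup>2)"
    proof -
      have "a * real t / (real t * x)\<^sup>2 = a / real t * (1 / x\<^sup>2)" for a x :: real
        using t by (simp add: power2_eq_square)
      then show ?thesis by blast
    qed
    also have "\<dots> \<le> Q ^ Suc k / real t * (1 / exp (- (2 * R * real m ^ k)))"
      using dens Q density_pos[of k] by (intro mult_left_mono divide_left_mono) auto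
    also have "\<dots> = exp (ln Q * real (Suc k) + 2 * R * real m ^ k - ln (real t))"
    proof -
      have "Q ^ Suc k = exp (ln Q) ^ Suc k" using Q by simp
      then have "Q ^ Suc k = exp (ln Q * real (Suc k))" by (simp only: exp_of_nat2_mult)
      moreover have "1 / exp (- (2 * R * real m ^ k)) = exp (2 * R * real m ^ k)" by (simp add: exp_minus divide_inverse)
      ultimately show ?thesis using t by (simp add: exp_add exp_diff)
    qed
    finally have "measure_pmf.prob (P t) {G. goods t k G = {}} \<le> \<dots>" .
    moreover have "measure_pmf.prob (P t) {G. goods t k G \<noteq> {}} = 1 - measure_pmf.prob (P t) {G. goods t k G = {}}"
    proof -
      have "{G. goods t k G \<noteq> {}} = space (measure_pmf (P t)) - {G. goods t k G = {}}" by auto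
      then show ?thesis by (simp only: measure_pmf.prob_compl sets_measure_pmf UNIV_I)
    qed
    ultimately show ?thesis by simp
  qed
  moreover have "0 < ln Q" "0 < 2 * R" using Q R(1) by auto
  ultimately show ?thesis by (intro that[of "ln Q" "2 * R"])
qed

text \<open>Here \<open>m ^ k\<close> is at most \<open>m * ln t powr \<epsilon>\<close>, where the
  factor \<open>m\<close> pays for rounding \<open>k\<close> up. As \<open>\<epsilon> < 1\<close>,
  this is of smaller order than \<open>ln t\<close>, so the error in \<open>prob_goods_ge\<close>
  tends to 0.\<close>

lemma whp_goods:
  fixes \<epsilon> :: real
  assumes \<epsilon>: "0 < \<epsilon>" "\<epsilon> < 1"
  shows "(\<lambda>t. measure_pmf.prob (P t)
    {G. goods t (nat \<lceil>\<epsilon> / ln (real m) * ln (ln (real t))\<rceil>) G \<noteq> {}}) \<longlonglongrightarrow> 1"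
proof -
  let ?k = "\<lambda>t. nat \<lceil>\<epsilon> / ln (real m) * ln (ln (real t))\<rceil>"
  obtain q R where qR: "0 < q" "0 < R" and prob:
    "\<And>t k. t \<ge> 4 \<Longrightarrow> 3 * C * real (m ^ Suc k) \<le> real t \<Longrightarrow>
      measure_pmf.prob (P t) {G. goods t k G \<noteq> {}} \<ge> 1 - exp (q * real (Suc k) + R * real m ^ k - ln (real t))"
    using prob_goods_ge by blast
  define l where "l = ln (real m)"
  have l: "0 < l" using m by (simp add: l_def)
  let ?f = "\<lambda>t::nat. exp (q * (\<epsilon> / l * ln (ln (real t)) + 2) + R * (real m * ln (real t) powr \<epsilon>) - ln (real t))"
  have f: "?f \<longlonglongrightarrow> 0"
    using l \<epsilon> m qR by real_asymp
  have "eventually (\<lambda>t::nat. 3 * C * (real m * (real m * ln (real t) powr \<epsilon>)) \<le> real t) sequentially"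
    using \<epsilon> m C by real_asymp
  moreover have "eventually (\<lambda>t::nat. 1 \<le> ln (real t)) sequentially" by real_asymp
  moreover have "eventually (\<lambda>t::nat. 4 \<le> t) sequentially" by (rule eventually_ge_at_top)
  ultimately have lower: "eventually (\<lambda>t. 1 - ?f t \<le> measure_pmf.prob (P t) {G. goods t (?k t) G \<noteq> {}}) sequentially"
  proof eventually_elim
    case (elim t)
    \<comment> \<open>Nonnegativity ensures that \<open>nat\<close> does not truncate.\<close>
    have "0 \<le> \<epsilon> / l * ln (ln (real t))" using elim l \<epsilon> by simp
    then have k: "real (?k t) \<le> \<epsilon> / l * ln (ln (real t)) + 1"
      unfolding l_def by linarith
    have "real m ^ ?k t = exp (real (?k t) * l)"
      using m by (simp add: l_def exp_of_nat_mult)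
    also have "\<dots> \<le> exp ((\<epsilon> / l * ln (ln (real t)) + 1) * l)"
      using k l by (simp add: mult_right_mono)
    also have "\<dots> = real m * ln (real t) powr \<epsilon>"
      using l elim m by (simp add: algebra_simps exp_add powr_def l_def)
    finally have mk: "real m ^ ?k t \<le> real m * ln (real t) powr \<epsilon>" .
    have "3 * C * real (m ^ Suc (?k t)) \<le> 3 * C * (real m * (real m * ln (real t) powr \<epsilon>))"
      using mk C by (simp add: mult_left_mono)
    also have "\<dots> \<le> real t" by (rule elim(1))
    finally have "1 - exp (q * real (Suc (?k t)) + R * real m ^ ?k t - ln (real t)) \<le>
        measure_pmf.prob (P t) {G. goods t (?k t) G \<noteq> {}}"
      by (intro prob elim)
    moreover have "q * real (Suc (?k t)) + R * real m ^ ?k t \<le>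
        q * (\<epsilon> / l * ln (ln (real t)) + 2) + R * (real m * ln (real t) powr \<epsilon>)"
      using k mk qR by (intro add_mono mult_left_mono) auto
    then have "exp (q * real (Suc (?k t)) + R * real m ^ ?k t - ln (real t)) \<le> ?f t" by simp
    ultimately show ?case by linarith
  qed
  have lim: "(\<lambda>t. 1 - ?f t) \<longlonglongrightarrow> 1" using tendsto_diff[OF tendsto_const f, of 1] by simp
  show ?thesis
    by (rule tendsto_sandwich[OF lower _ lim tendsto_const])
      (rule always_eventually, rule allI, rule measure_pmf.prob_le_1)
qed

text \<open>\<open>h\<close> reads the graph of the model off the state: \<open>merge m\<close> in
  models (a) and (b), the identity in model (c).\<close>

lemma whp_diam:
  fixes \<epsilon> :: real and h :: "'g \<Rightarrow> multigraph"
  assumes \<epsilon>: "0 < \<epsilon>" "\<epsilon> < 1"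
    and h: "\<And>t G. t \<ge> 2 \<Longrightarrow> G \<in> set_pmf (P t) \<Longrightarrow> verts (h G) = {1..t} \<and> adjacency (h G) = A G"
  shows "(\<lambda>t. measure_pmf.prob (map_pmf h (P t))
    {G. \<epsilon> / ln (real m) * ln (ln (real t)) \<le> real (diam G)}) \<longlonglongrightarrow> 1"
proof (rule tendsto_sandwich[OF _ _ whp_goods[OF \<epsilon>] tendsto_const])
  let ?x = "\<lambda>t. \<epsilon> / ln (real m) * ln (ln (real t))"
  show "eventually (\<lambda>t. measure_pmf.prob (P t) {G. goods t (nat \<lceil>?x t\<rceil>) G \<noteq> {}} \<le>
      measure_pmf.prob (map_pmf h (P t)) {G. ?x t \<le> real (diam G)}) sequentially"
    using eventually_ge_at_top[of 2]
  proof eventually_elim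
    case (elim t)
    have "?x t \<le> real (diam (h G))" if G: "G \<in> set_pmf (P t)" and ne: "goods t (nat \<lceil>?x t\<rceil>) G \<noteq> {}" for G
    proof -
      obtain v where v: "v \<in> {1..t}" "good m (A G) (d G) (nat \<lceil>?x t\<rceil>) v"
        using ne by (auto simp: goods_def)
      have "nat \<lceil>?x t\<rceil> \<le> diam (h G)"
        using h[OF elim G] A[OF elim G] v by (intro diam_good[of "h G" v m "d G"]) auto
      then show ?thesis by linarith
    qed
    then show ?case
      by (auto intro!: measure_pmf.finite_measure_mono_AE simp: AE_measure_pmf_iff)
  qed
qed (rule always_eventually, rule allI, rule measure_pmf.prob_le_1)

end

subsection \<open>Probabilities of composed kernels\<close>

lemma prob_bind_pmf:
  "measure_pmf.prob (bind_pmf p f) X = measure_pmf.expectation p (\<lambda>x. measure_pmf.prob (f x) X)"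
  using expectation_bind_pmf[of "indicator X" 1 p f] by (simp add: indicator_def)

text \<open>Union bound over whether the first stage falls into the bad set
  \<open>Y\<close>.\<close>

lemma prob_bind_le:
  assumes "\<And>x. x \<in> set_pmf p \<Longrightarrow> x \<notin> Y \<Longrightarrow> measure_pmf.prob (f x) X \<le> r" "0 \<le> r"
  shows "measure_pmf.prob (bind_pmf p f) X \<le> measure_pmf.prob p Y + r"
proof -
  have int: "integrable (measure_pmf p) (indicator Y :: _ \<Rightarrow> real)"
    by (intro integrable_real_indicator) (simp_all add: less_top[symmetric])
  have "measure_pmf.prob (bind_pmf p f) X \<le> measure_pmf.expectation p (\<lambda>x. indicator Y x + r)"
    unfolding prob_bind_pmf
  proof (rule integral_mono_AE)
    show "integrable (measure_pmf p) (\<lambda>x. measure_pmf.prob (f x) X)"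
      by (intro measure_pmf.integrable_const_bound[where B = 1]) (auto simp: measure_pmf.prob_le_1)
    show "AE x in measure_pmf p. measure_pmf.prob (f x) X \<le> indicator Y x + r"
      using assms add_increasing2[OF assms(2) measure_pmf.prob_le_1] by (auto simp: AE_measure_pmf_iff indicator_def)
  qed (use int in simp)
  also have "\<dots> = measure_pmf.prob p Y + r"
    using int by (subst Bochner_Integration.integral_add) (auto simp: measure_pmf.prob_space)
  finally show ?thesis .
qed

lemma prob_bind_ge:
  assumes "\<And>x. x \<in> set_pmf p \<Longrightarrow> x \<in> Y \<Longrightarrow> r \<le> measure_pmf.prob (f x) X"
  shows "measure_pmf.prob p Y * r \<le> measure_pmf.prob (bind_pmf p f) X"
proof -
  have int: "integrable (measure_pmf p) (indicator Y :: _ \<Rightarrow> real)"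
    by (intro integrable_real_indicator) (simp_all add: less_top[symmetric])
  have "measure_pmf.prob p Y * r = measure_pmf.expectation p (\<lambda>x. indicator Y x * r)" by simp
  also have "\<dots> \<le> measure_pmf.prob (bind_pmf p f) X"
    unfolding prob_bind_pmf
  proof (rule integral_mono_AE)
    show "integrable (measure_pmf p) (\<lambda>x. measure_pmf.prob (f x) X)"
      by (intro measure_pmf.integrable_const_bound[where B = 1]) (auto simp: measure_pmf.prob_le_1)
    show "AE x in measure_pmf p. indicator Y x * r \<le> measure_pmf.prob (f x) X"
      using assms by (auto simp: AE_measure_pmf_iff indicator_def)
  qed (use int in \<open>simp add: mult.commute[of _ r]\<close>)
  finally show ?thesis .
qed

lemma prob_mono_set_pmf:
  assumes "\<And>x. x \<in> set_pmf p \<Longrightarrow> x \<in> X \<Longrightarrow> x \<in> Y"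
  shows "measure_pmf.prob p X \<le> measure_pmf.prob p Y"
  using assms by (intro measure_pmf.finite_measure_mono_AE) (auto simp: AE_measure_pmf_iff)

subsection \<open>The models\<close>

text \<open>If \<open>v\<close> occurs in \<open>js\<close>, the loop is counted in
  \<open>length js\<close> and again in \<open>count_list js v\<close>, as loops count
  twice.\<close>

lemma vdegree_add_vertex:
  "vdegree (add_vertex v js G) i = vdegree G i + (if i = v then length js else 0) + count_list js i"
proof -
  have "size {#e \<in># mset (map (Upair v) js). i \<in> set_uprod e#} + count (mset (map (Upair v) js)) (Upair i i) =
      (if i = v then length js else 0) + count_list js i"
    by (induction js) auto
  then show ?thesis by (simp add: vdegree_def add_vertex_def)
qed

lemma vdegree_eq_0:
  assumes "pa_graph m t G" "i \<notin> {1..t}"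
  shows "vdegree G i = 0"
proof -
  have "i \<notin> set_uprod e" if "e \<in># edges G" for e
    using assms that unfolding pa_graph_def by blast
  then have "{#e \<in># edges G. i \<in> set_uprod e#} = {#}" "Upair i i \<notin># edges G"
    by (auto, metis Un_iff insertI1 set_uprod_simps)
  then show ?thesis by (simp add: vdegree_def not_in_iff)
qed

lemma adjacency_add_vertex:
  "adjacency (add_vertex v js G) = adjacency G \<union> {v} \<times> set js \<union> set js \<times> {v}"
  by (auto simp: adjacency_def add_vertex_def)

lemma adjacency_pa_graph:
  assumes "pa_graph m t G"
  shows "adjacency G \<subseteq> {1..t} \<times> {1..t}"
  using assms by (fastforce simp: adjacency_def pa_graph_def)

section \<open>Model (c)\<close>

lemma prob_replicate_hit:
  "measure_pmf.prob (replicate_pmf n p) {xs. set xs \<inter> T \<noteq> {}} \<le> real n * measure_pmf.prob p T"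
proof (induction n)
  case (Suc n)
  have "measure_pmf.prob (replicate_pmf (Suc n) p) {xs. set xs \<inter> T \<noteq> {}} \<le>
      measure_pmf.prob p T + real n * measure_pmf.prob p T"
    unfolding replicate_pmf.simps(2)
  proof (rule prob_bind_le)
    fix x assume "x \<notin> T"
    then have "measure_pmf.prob (replicate_pmf n p \<bind> (\<lambda>xs. return_pmf (x # xs))) {xs. set xs \<inter> T \<noteq> {}} =
        measure_pmf.prob (replicate_pmf n p) {xs. set xs \<inter> T \<noteq> {}}"
      by (simp add: map_pmf_def[symmetric] vimage_def)
    with Suc show "measure_pmf.prob (replicate_pmf n p \<bind> (\<lambda>xs. return_pmf (x # xs))) {xs. set xs \<inter> T \<noteq> {}} \<le>
        real n * measure_pmf.prob p T" by simp
  qed simp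
  then show ?case by (simp add: algebra_simps)
qed simp

lemma prob_replicate_subset:
  "measure_pmf.prob p U ^ n \<le> measure_pmf.prob (replicate_pmf n p) {xs. set xs \<subseteq> U}"
proof (induction n)
  case (Suc n)
  have "measure_pmf.prob p U * measure_pmf.prob p U ^ n \<le>
      measure_pmf.prob (replicate_pmf (Suc n) p) {xs. set xs \<subseteq> U}"
    unfolding replicate_pmf.simps(2)
  proof (rule prob_bind_ge)
    fix x assume "x \<in> U"
    then have "measure_pmf.prob (replicate_pmf n p \<bind> (\<lambda>xs. return_pmf (x # xs))) {xs. set xs \<subseteq> U} =
        measure_pmf.prob (replicate_pmf n p) {xs. set xs \<subseteq> U}"
      by (simp add: map_pmf_def[symmetric] vimage_def)
    with Suc show "measure_pmf.prob p U ^ n \<le>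
        measure_pmf.prob (replicate_pmf n p \<bind> (\<lambda>xs. return_pmf (x # xs))) {xs. set xs \<subseteq> U}" by simp
  qed
  then show ?case by simp
qed simp

text \<open>An end point falls on a given vertex of degree at most \<open>3 * m\<close> with
  probability at most \<open>(3 * m + \<bar>\<delta>\<bar>) / (s * (2 * m + \<delta>))\<close>, and
  a union bound over the \<open>m\<close> end points gives \<open>C\<close>. All degrees are at
  least \<open>m\<close>, which gives \<open>c\<close>.\<close>

lemma attachment_PA_c:
  assumes m: "m \<ge> 2" and \<delta>: "\<delta> > - real m"
  shows "attachment m (max 8 (real m * (3 * real m + \<bar>\<delta>\<bar>) / (2 * real m + \<delta>))) ((real m + \<delta>) / (2 * real m + \<delta>))
    (PA_c m \<delta>) (\<lambda>s G. map_pmf (\<lambda>js. add_vertex (s + 1) js G) (replicate_pmf m (endpoint_old m \<delta> s G)))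
    adjacency vdegree"
    (is "attachment m ?C ?c _ _ _ _")
proof
  have pos: "0 < 2 * real m + \<delta>" using m \<delta> by simp
  show "2 \<le> m" by (rule m)
  show "8 \<le> ?C" by simp
  show "0 < ?c" "?c \<le> 1" using pos \<delta> m by auto
  fix s :: nat assume s: "2 \<le> s"
  show "PA_c m \<delta> (Suc s) = PA_c m \<delta> s \<bind>
      (\<lambda>G. map_pmf (\<lambda>js. add_vertex (s + 1) js G) (replicate_pmf m (endpoint_old m \<delta> s G)))"
    using s by (simp add: PA_c_def)
  fix G assume G: "G \<in> set_pmf (PA_c m \<delta> s)"
  have pa: "pa_graph m s G" using pa_graph_PA_c[of m \<delta> s G] m \<delta> s G by simp
  let ?e = "endpoint_old m \<delta> s G"
  have pmf: "pmf ?e i = (if i \<in> {1..s} then (real (vdegree G i) + \<delta>) / (real s * (2 * real m + \<delta>)) else 0)" for i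
    using pmf_endpoint_old[OF pa] m s \<delta> by simp
  have supp: "set_pmf ?e \<subseteq> {1..s}"
    by (auto simp: set_pmf_eq_pos pmf split: if_splits)
  show A: "adjacency G \<subseteq> {1..s} \<times> {1..s}" by (rule adjacency_pa_graph[OF pa])
  have nbr: "adjacency (add_vertex (Suc s) js G) `` {Suc s} = set js" if "set js \<subseteq> {1..s}" for js
    using A that by (auto simp: adjacency_add_vertex)
  {
    fix G' assume "G' \<in> set_pmf (map_pmf (\<lambda>js. add_vertex (s + 1) js G) (replicate_pmf m ?e))"
    then obtain js where js: "length js = m" "set js \<subseteq> {1..s}" "G' = add_vertex (Suc s) js G"
      using supp by (auto simp: set_replicate_pmf)
    have "count_list js i \<le> m" for i using count_le_length[of js i] js(1) by simp
    then show "attached m (Suc s) (adjacency G) (vdegree G) (adjacency G') (vdegree G')"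
      using js m vdegree_eq_0[OF pa, of "Suc s"] card_length[of js]
      unfolding attached_def js(3) nbr[OF js(2)]
      by (auto simp: adjacency_add_vertex vdegree_add_vertex count_list_0_iff)
  }
  {
    fix T assume T: "T \<subseteq> {1..s}" "\<And>u. u \<in> T \<Longrightarrow> vdegree G u \<le> 3 * m"
    have fin: "finite T" using T(1) finite_subset by blast
    have "measure_pmf.prob ?e T = (\<Sum>u\<in>T. pmf ?e u)" by (rule measure_measure_pmf_finite[OF fin])
    also have "\<dots> \<le> (\<Sum>u\<in>T. (3 * real m + \<bar>\<delta>\<bar>) / (real s * (2 * real m + \<delta>)))"
    proof (rule sum_mono)
      fix u assume u: "u \<in> T"
      then have "real (vdegree G u) \<le> real (3 * m)" using T(2) by (intro of_nat_mono)
      then show "pmf ?e u \<le> (3 * real m + \<bar>\<delta>\<bar>) / (real s * (2 * real m + \<delta>))"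
        using u T(1) pos by (auto simp: pmf intro!: divide_right_mono)
    qed
    finally have T_le: "measure_pmf.prob ?e T \<le> real (card T) * ((3 * real m + \<bar>\<delta>\<bar>) / (real s * (2 * real m + \<delta>)))"
      by simp
    have "measure_pmf.prob (map_pmf (\<lambda>js. add_vertex (s + 1) js G) (replicate_pmf m ?e))
        {G'. adjacency G' `` {Suc s} \<inter> T \<noteq> {}} \<le> measure_pmf.prob (replicate_pmf m ?e) {js. set js \<inter> T \<noteq> {}}"
      unfolding measure_map_pmf
    proof (rule prob_mono_set_pmf)
      fix js assume "js \<in> set_pmf (replicate_pmf m ?e)"
        and hit: "js \<in> (\<lambda>js. add_vertex (s + 1) js G) -` {G'. adjacency G' `` {Suc s} \<inter> T \<noteq> {}}"
      then have "set js \<subseteq> {1..s}" using supp by (auto simp: set_replicate_pmf)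
      then show "js \<in> {js. set js \<inter> T \<noteq> {}}" using hit nbr by simp
    qed
    also have "\<dots> \<le> real m * measure_pmf.prob ?e T" by (rule prob_replicate_hit)
    also have "\<dots> \<le> real m * (real (card T) * ((3 * real m + \<bar>\<delta>\<bar>) / (real s * (2 * real m + \<delta>))))"
      using T_le by (intro mult_left_mono) auto
    also have "\<dots> = (real m * (3 * real m + \<bar>\<delta>\<bar>) / (2 * real m + \<delta>)) * real (card T) / real s"
      by (simp add: mult_ac)
    also have "\<dots> \<le> ?C * real (card T) / real s"
      by (intro divide_right_mono mult_right_mono) auto
    finally show "measure_pmf.prob (map_pmf (\<lambda>js. add_vertex (s + 1) js G) (replicate_pmf m ?e))
        {G'. adjacency G' `` {Suc s} \<inter> T \<noteq> {}} \<le> ?C * real (card T) / real s" .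
  }
  {
    fix U assume U: "U \<subseteq> {1..s}"
    have fin: "finite U" using U finite_subset by blast
    have "?c * real (card U) / real s = (\<Sum>u\<in>U. (real m + \<delta>) / (real s * (2 * real m + \<delta>)))"
      by (simp add: mult_ac)
    also have "\<dots> \<le> (\<Sum>u\<in>U. pmf ?e u)"
    proof (rule sum_mono)
      fix u assume u: "u \<in> U"
      then have "m \<le> vdegree G u" using U pa by (auto simp: pa_graph_def)
      then show "(real m + \<delta>) / (real s * (2 * real m + \<delta>)) \<le> pmf ?e u"
        using u U pos by (auto simp: pmf intro!: divide_right_mono)
    qed
    also have "\<dots> = measure_pmf.prob ?e U" by (rule measure_measure_pmf_finite[OF fin, symmetric])
    finally have "(?c * real (card U) / real s) ^ m \<le> measure_pmf.prob ?e U ^ m"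
      using pos \<delta> by (intro power_mono) auto
    also have "\<dots> \<le> measure_pmf.prob (replicate_pmf m ?e) {js. set js \<subseteq> U}" by (rule prob_replicate_subset)
    also have "\<dots> \<le> measure_pmf.prob (map_pmf (\<lambda>js. add_vertex (s + 1) js G) (replicate_pmf m ?e))
        {G'. adjacency G' `` {Suc s} \<subseteq> U}"
      unfolding measure_map_pmf using nbr U by (intro prob_mono_set_pmf) auto
    finally show "(?c * real (card U) / real s) ^ m \<le>
        measure_pmf.prob (map_pmf (\<lambda>js. add_vertex (s + 1) js G) (replicate_pmf m ?e))
        {G'. adjacency G' `` {Suc s} \<subseteq> U}" .
  }
qed

section \<open>Merging blocks of vertices\<close>

text \<open>The degree after merging, read off the unmerged graph: an edge inside a block counts at
  both ends, as the resulting loop does.\<close>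

definition block_degree :: "nat \<Rightarrow> multigraph \<Rightarrow> nat \<Rightarrow> nat" where
  "block_degree m G u = (\<Sum>i\<in>{m * (u - 1) + 1..m * u}. vdegree G i)"

lemma block_eq_iff:
  assumes "m \<ge> 1" "i \<ge> 1" "u \<ge> 1"
  shows "block m i = u \<longleftrightarrow> i \<in> {m * (u - 1) + 1..m * u}"
proof -
  obtain i' u' where iu: "i = Suc i'" "u = Suc u'" using assms by (metis Suc_le_D One_nat_def)
  have "i' div m = u' \<longleftrightarrow> m * u' \<le> i' \<and> i' < m * u' + m"
    using assms(1) dividend_less_times_div[of m i'] times_div_less_eq_dividend[of m i'] div_nat_eqI[of m u' i']
    by (auto simp: algebra_simps)
  then show ?thesis by (auto simp: block_def iu)
qed

lemma block_in_interval:
  assumes "m \<ge> 1" "i \<in> {1..m * t}"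
  shows "block m i \<in> {1..t}"
proof -
  have "i - 1 < t * m" using assms by (auto simp: mult.commute[of t])
  then show ?thesis by (auto simp: block_def less_eq_Suc_le[symmetric] less_mult_imp_div_less)
qed

lemma block_degree_add_vertex:
  assumes "m \<ge> 1" "v \<ge> 1" "j \<ge> 1"
  shows "block_degree m (add_vertex v [j] G) u =
    block_degree m G u + of_bool (block m v = u) + of_bool (block m j = u)"
proof (cases "u = 0")
  case False
  have "(\<Sum>i\<in>{m * (u - 1) + 1..m * u}. of_bool (i = w)) = (of_bool (block m w = u) :: nat)" if "w \<ge> 1" for w
    using block_eq_iff[of m w u] assms(1) that False by (simp add: of_bool_def sum.delta')
  then have *: "(\<Sum>i\<in>{m * (u - 1) + 1..m * u}. of_bool (i = v)) = (of_bool (block m v = u) :: nat)"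
    "(\<Sum>i\<in>{m * (u - 1) + 1..m * u}. of_bool (i = j)) = (of_bool (block m j = u) :: nat)"
    using assms by auto
  have deg: "vdegree (add_vertex v [j] G) i = vdegree G i + of_bool (i = v) + of_bool (i = j)" for i
    by (simp add: vdegree_add_vertex)
  show ?thesis unfolding block_degree_def * [symmetric] deg by (simp only: sum.distrib)
qed (simp add: block_degree_def block_def)

lemma adjacency_merge: "adjacency (merge m G) = map_prod (block m) (block m) ` adjacency G"
proof
  show "adjacency (merge m G) \<subseteq> map_prod (block m) (block m) ` adjacency G"
  proof
    fix p assume "p \<in> adjacency (merge m G)"
    then obtain x y e where p: "p = (x, y)" "e \<in># edges G" "Upair x y = map_uprod (block m) e"
      by (auto simp: adjacency_def merge_def)
    obtain a b where e: "e = Upair a b" by (cases e)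
    then consider "x = block m a" "y = block m b" | "x = block m b" "y = block m a" using p by auto
    moreover have "(a, b) \<in> adjacency G" "(b, a) \<in> adjacency G"
      using p(2) sym_adjacency[of G] unfolding e by (auto simp: adjacency_def sym_def)
    ultimately show "p \<in> map_prod (block m) (block m) ` adjacency G" unfolding p(1) by cases force+
  qed
  show "map_prod (block m) (block m) ` adjacency G \<subseteq> adjacency (merge m G)"
    by (auto simp: adjacency_def merge_def intro!: image_eqI[of "Upair _ _"])
qed

text \<open>The law of the graph after \<open>l\<close> unit steps from \<open>G\<close> at time \<open>n\<close>. The recursion splits off the first
  step, as the union bounds below require.\<close>

primrec run :: "(nat \<Rightarrow> multigraph \<Rightarrow> nat pmf) \<Rightarrow> nat \<Rightarrow> nat \<Rightarrow> multigraph \<Rightarrow> multigraph pmf" where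
  "run e 0 n G = return_pmf G"
| "run e (Suc l) n G = bind_pmf (e n G) (\<lambda>j. run e l (Suc n) (add_vertex (Suc n) [j] G))"

text \<open>Here \<open>\<delta>\<close> is the parameter \<open>\<delta> / m\<close> of the unit
  chain. The denominators \<open>n * (2 + \<delta>)\<close> of model (b) and
  \<open>n * (2 + \<delta>) + (1 + \<delta>)\<close> of model (a) both lie between those in
  \<open>pmf_le\<close> and \<open>pmf_ge\<close>.\<close>

locale unit_attachment =
  fixes m :: nat and \<delta> :: real and e :: "nat \<Rightarrow> multigraph \<Rightarrow> nat pmf" and M :: "nat \<Rightarrow> multigraph pmf"
  assumes m: "m \<ge> 2" and \<delta>: "\<delta> > - 1"
    and unit_chain: "n \<ge> 2 \<Longrightarrow> M (Suc n) = bind_pmf (M n) (\<lambda>G. map_pmf (\<lambda>j. add_vertex (Suc n) [j] G) (e n G))"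
    and pa: "n \<ge> 2 \<Longrightarrow> G \<in> set_pmf (M n) \<Longrightarrow> pa_graph 1 n G"
    and supp: "n \<ge> 2 \<Longrightarrow> pa_graph 1 n G \<Longrightarrow> set_pmf (e n G) \<subseteq> {1..Suc n}"
    and pmf_ge: "n \<ge> 2 \<Longrightarrow> pa_graph 1 n G \<Longrightarrow> i \<in> {1..n} \<Longrightarrow>
      (real (vdegree G i) + \<delta>) / (real (Suc n) * (2 + \<delta>)) \<le> pmf (e n G) i"
    and pmf_le: "n \<ge> 2 \<Longrightarrow> pa_graph 1 n G \<Longrightarrow> i \<in> {1..n} \<Longrightarrow>
      pmf (e n G) i \<le> (real (vdegree G i) + \<delta>) / (real n * (2 + \<delta>))"
begin

abbreviation AM :: "multigraph \<Rightarrow> (nat \<times> nat) set" where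
  "AM G \<equiv> adjacency (merge m G)"

lemma M_add: "n \<ge> 2 \<Longrightarrow> M (n + l) = bind_pmf (M n) (run e l n)"
proof (induction l arbitrary: n)
  case (Suc l)
  have "M (n + Suc l) = bind_pmf (M (Suc n)) (run e l (Suc n))" using Suc.IH[of "Suc n"] Suc.prems by simp
  also have "\<dots> = bind_pmf (M n) (run e (Suc l) n)"
  proof -
    have "run e (Suc l) n = (\<lambda>G. bind_pmf (e n G) (\<lambda>j. run e l (Suc n) (add_vertex (Suc n) [j] G)))"
      by (rule ext) simp
    then show ?thesis unfolding unit_chain[OF Suc.prems] by (simp add: bind_assoc_pmf bind_map_pmf)
  qed
  finally show ?case .
next
  case 0
  have "run e 0 n = return_pmf" by (rule ext) simp
  then show ?case by (simp add: bind_return_pmf')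
qed

lemma pa_add:
  assumes "n \<ge> 2" "pa_graph 1 n G" "j \<in> set_pmf (e n G)"
  shows "pa_graph 1 (Suc n) (add_vertex (Suc n) [j] G)"
  using subsetD[OF supp[OF assms(1,2)] assms(3)] by (intro pa_graph_add_vertex assms(2)) auto

lemma AM_add: "AM (add_vertex v [j] G) = AM G \<union> {(block m v, block m j), (block m j, block m v)}"
  by (auto simp: adjacency_merge adjacency_add_vertex image_Un)

lemma AM_pa_graph:
  assumes "pa_graph 1 (m * s) G"
  shows "AM G \<subseteq> {1..s} \<times> {1..s}"
proof -
  have "block m i \<in> {1..s}" if "i \<in> {1..m * s}" for i
    using block_in_interval[OF _ that] m by simp
  then show ?thesis using adjacency_pa_graph[OF assms] by (fastforce simp: adjacency_merge)
qed

text \<open>All \<open>l\<close> new unit vertices belong to block \<open>v\<close>, so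
  \<open>js\<close> collects their end points; those inside the block become loops.\<close>

lemma set_pmf_run:
  assumes "n \<ge> 2" "pa_graph 1 n H" "G' \<in> set_pmf (run e l n H)"
    and "\<And>i. i \<in> {n + 1..n + l} \<Longrightarrow> block m i = v"
  shows "\<exists>js. length js = l \<and> set js \<subseteq> {1..n + l} \<and>
    AM G' = AM H \<union> {v} \<times> block m ` set js \<union> (block m ` set js) \<times> {v} \<and>
    (\<forall>u. block_degree m G' u = block_degree m H u + (if u = v then l else 0) +
      length (filter (\<lambda>j. block m j = u) js))"
  using assms
proof (induction l arbitrary: n H)
  case (Suc l)
  then obtain j where j: "j \<in> set_pmf (e n H)" and G': "G' \<in> set_pmf (run e l (Suc n) (add_vertex (Suc n) [j] H))"
    by auto
  have j1: "j \<in> {1..Suc n}" using supp[OF Suc.prems(1,2)] j by auto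
  have v: "block m (Suc n) = v" using Suc.prems(4) by simp
  from Suc.IH[OF _ pa_add[OF Suc.prems(1,2) j] G'] Suc.prems(1,4)
  obtain js where js: "length js = l" "set js \<subseteq> {1..Suc n + l}"
    "AM G' = AM (add_vertex (Suc n) [j] H) \<union> {v} \<times> block m ` set js \<union> (block m ` set js) \<times> {v}"
    "\<And>u. block_degree m G' u = block_degree m (add_vertex (Suc n) [j] H) u + (if u = v then l else 0) +
      length (filter (\<lambda>j. block m j = u) js)" by auto
  show ?case
  proof (intro exI[of _ "j # js"] conjI allI)
    show "AM G' = AM H \<union> {v} \<times> block m ` set (j # js) \<union> block m ` set (j # js) \<times> {v}"
      unfolding js(3) AM_add v by auto
    show "block_degree m G' u = block_degree m H u + (if u = v then Suc l else 0) +
      length (filter (\<lambda>j. block m j = u) (j # js))" for u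
      using js(4)[of u] block_degree_add_vertex[of m "Suc n" j H u] m j1 v by auto
  qed (use js j1 in auto)
qed auto

definition blocks :: "nat set \<Rightarrow> nat set" where
  "blocks T = (\<Union>u\<in>T. {m * (u - 1) + 1..m * u})"

lemma blocks:
  assumes "T \<subseteq> {1..s}"
  shows "finite (blocks T)" "blocks T \<subseteq> {1..m * s}" "card (blocks T) = m * card T"
    and "(\<Sum>i\<in>blocks T. f i) = (\<Sum>u\<in>T. \<Sum>i\<in>{m * (u - 1) + 1..m * u}. f i :: real)"
    and "i \<ge> 1 \<Longrightarrow> block m i \<in> T \<longleftrightarrow> i \<in> blocks T"
proof -
  have fin: "finite T" using assms finite_subset by blast
  have mem: "i \<in> {m * (u - 1) + 1..m * u} \<longleftrightarrow> i \<ge> 1 \<and> block m i = u" if "u \<in> T" for i u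
    using block_eq_iff[of m i u] m that assms by force
  have disj: "{m * (u - 1) + 1..m * u} \<inter> {m * (u' - 1) + 1..m * u'} = {}" if "u \<in> T" "u' \<in> T" "u \<noteq> u'" for u u'
  proof (rule equals0I)
    fix i assume i: "i \<in> {m * (u - 1) + 1..m * u} \<inter> {m * (u' - 1) + 1..m * u'}"
    have "block m i = u" using iffD1[OF mem[OF that(1)] IntD1[OF i]] ..
    moreover have "block m i = u'" using iffD1[OF mem[OF that(2)] IntD2[OF i]] ..
    ultimately show False using that(3) by simp
  qed
  show "finite (blocks T)" using fin by (simp add: blocks_def)
  show "blocks T \<subseteq> {1..m * s}"
  proof
    fix i assume "i \<in> blocks T"
    then obtain u where u: "u \<in> T" "i \<in> {m * (u - 1) + 1..m * u}" by (auto simp: blocks_def)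
    have "m * u \<le> m * s" using u(1) assms by (intro mult_left_mono) auto
    with u(2) show "i \<in> {1..m * s}" unfolding atLeastAtMost_iff by linarith
  qed
  have "card (blocks T) = (\<Sum>u\<in>T. card {m * (u - 1) + 1..m * u})"
    unfolding blocks_def using fin disj by (intro card_UN_disjoint) auto
  also have "\<dots> = (\<Sum>u\<in>T. m)"
  proof (rule sum.cong)
    fix u assume "u \<in> T"
    then obtain u' where "u = Suc u'" using assms by (cases u) auto
    then show "card {m * (u - 1) + 1..m * u} = m" by simp
  qed simp
  finally show "card (blocks T) = m * card T" by simp
  show "(\<Sum>i\<in>blocks T. f i) = (\<Sum>u\<in>T. \<Sum>i\<in>{m * (u - 1) + 1..m * u}. f i)"
    unfolding blocks_def using fin disj by (intro sum.UNION_disjoint) auto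
  show "i \<ge> 1 \<Longrightarrow> block m i \<in> T \<longleftrightarrow> i \<in> blocks T" using mem by (auto simp: blocks_def)
qed

lemma prob_endpoint:
  assumes "n \<ge> 2" "pa_graph 1 n H" "T \<subseteq> {1..s}"
  shows "measure_pmf.prob (e n H) {j. block m j \<in> T} = (\<Sum>i\<in>blocks T. pmf (e n H) i)"
proof -
  \<comment> \<open>The support excludes the label 0, for which truncated subtraction gives
    \<open>block m 0 = 1\<close>.\<close>
  have "measure_pmf.prob (e n H) {j. block m j \<in> T} = measure_pmf.prob (e n H) (blocks T)"
    using supp[OF assms(1,2)] blocks(2,5)[OF assms(3)]
    by (intro antisym prob_mono_set_pmf) (auto simp: subset_iff)
  also have "\<dots> = (\<Sum>i\<in>blocks T. pmf (e n H) i)"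
    by (rule measure_measure_pmf_finite) (rule blocks(1)[OF assms(3)])
  finally show ?thesis .
qed

text \<open>As long as \<open>T\<close> is missed, its degrees do not change, so its weight stays
  below \<open>W\<close> and each of the \<open>l\<close> steps hits it with probability at most
  \<open>W / (m * s * (2 + \<delta>))\<close>.\<close>

lemma prob_run_hit:
  assumes "n \<ge> 2" "pa_graph 1 n H" "T \<subseteq> {1..s}" "m * s \<le> n"
    and "\<And>i. i \<in> {n + 1..n + l} \<Longrightarrow> block m i = Suc s" "AM H `` {Suc s} \<inter> T = {}" "s \<ge> 1"
    and W: "(\<Sum>u\<in>T. real (block_degree m H u) + real m * \<delta>) \<le> W"
  shows "measure_pmf.prob (run e l n H) {G'. AM G' `` {Suc s} \<inter> T \<noteq> {}} \<le> real l * (W / (real (m * s) * (2 + \<delta>)))"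
  using assms
proof (induction l arbitrary: n H)
  case (Suc l)
  let ?r = "W / (real (m * s) * (2 + \<delta>))"
  have sub: "blocks T \<subseteq> {1..n}" using blocks(2)[OF Suc.prems(3)] Suc.prems(4) by force
  have nonneg: "0 \<le> (\<Sum>i\<in>blocks T. real (vdegree H i) + \<delta>)"
  proof (rule sum_nonneg)
    fix i assume "i \<in> blocks T"
    then have "1 \<le> vdegree H i" using sub Suc.prems(2) by (auto simp: pa_graph_def)
    then show "0 \<le> real (vdegree H i) + \<delta>" using \<delta> by linarith
  qed
  have sumW: "(\<Sum>i\<in>blocks T. real (vdegree H i) + \<delta>) \<le> W"
  proof -
    have "(\<Sum>i\<in>blocks T. real (vdegree H i) + \<delta>) = (\<Sum>u\<in>T. real (block_degree m H u) + real m * \<delta>)"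
      unfolding blocks(4)[OF Suc.prems(3)]
    proof (rule sum.cong)
      fix u assume "u \<in> T"
      then obtain u' where "u = Suc u'" using Suc.prems(3) by (cases u) auto
      then show "(\<Sum>i\<in>{m * (u - 1) + 1..m * u}. real (vdegree H i) + \<delta>) = real (block_degree m H u) + real m * \<delta>"
        by (simp add: block_degree_def sum.distrib)
    qed simp
    with Suc.prems(8) show ?thesis by simp
  qed
  \<comment> \<open>This sign allows the denominator to be lowered from time \<open>n\<close> to
    time \<open>m * s\<close>.\<close>
  then have W0: "0 \<le> W" using nonneg by linarith
  have "measure_pmf.prob (e n H) {j. block m j \<in> T} \<le> (\<Sum>i\<in>blocks T. (real (vdegree H i) + \<delta>) / (real n * (2 + \<delta>)))"
    unfolding prob_endpoint[OF Suc.prems(1-3)]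
    using pmf_le[OF Suc.prems(1,2)] sub by (intro sum_mono) auto
  also have "\<dots> = (\<Sum>i\<in>blocks T. real (vdegree H i) + \<delta>) / (real n * (2 + \<delta>))"
    by (rule sum_divide_distrib[symmetric])
  also have "\<dots> \<le> W / (real n * (2 + \<delta>))"
    using sumW \<delta> by (intro divide_right_mono) auto
  also have "\<dots> \<le> ?r"
  proof (rule divide_left_mono[OF _ W0])
    have "real (m * s) \<le> real n" using Suc.prems(4) by (intro of_nat_mono)
    then show "real (m * s) * (2 + \<delta>) \<le> real n * (2 + \<delta>)" using \<delta> by (intro mult_right_mono) auto
    show "0 < real n * (2 + \<delta>) * (real (m * s) * (2 + \<delta>))"
      using Suc.prems(1,7) m \<delta> by (intro mult_pos_pos) auto
  qed
  finally have first: "measure_pmf.prob (e n H) {j. block m j \<in> T} \<le> ?r" .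
  have "measure_pmf.prob (run e (Suc l) n H) {G'. AM G' `` {Suc s} \<inter> T \<noteq> {}} \<le>
      measure_pmf.prob (e n H) {j. block m j \<in> T} + real l * ?r"
    unfolding run.simps(2)
  proof (rule prob_bind_le)
    fix j assume j: "j \<in> set_pmf (e n H)" "j \<notin> {j. block m j \<in> T}"
    have j1: "j \<ge> 1" using supp[OF Suc.prems(1,2)] j(1) by auto
    have v: "block m (Suc n) = Suc s" using Suc.prems(5)[of "Suc n"] by simp
    have vT: "Suc s \<notin> T" using Suc.prems(3) by auto
    have deg: "block_degree m (add_vertex (Suc n) [j] H) u = block_degree m H u" if "u \<in> T" for u
    proof -
      have "u \<noteq> Suc s" "u \<noteq> block m j" using that vT j(2) by auto
      then show ?thesis using block_degree_add_vertex[of m "Suc n" j H u] m j1 v by simp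
    qed
    show "measure_pmf.prob (run e l (Suc n) (add_vertex (Suc n) [j] H)) {G'. AM G' `` {Suc s} \<inter> T \<noteq> {}} \<le> real l * ?r"
    proof (rule Suc.IH)
      show "pa_graph 1 (Suc n) (add_vertex (Suc n) [j] H)" by (rule pa_add[OF Suc.prems(1,2) j(1)])
      show "AM (add_vertex (Suc n) [j] H) `` {Suc s} \<inter> T = {}"
        unfolding AM_add v using Suc.prems(6) j(2) vT by auto
      show "(\<Sum>u\<in>T. real (block_degree m (add_vertex (Suc n) [j] H) u) + real m * \<delta>) \<le> W"
        using Suc.prems(8) by (simp add: deg)
    qed (use Suc.prems in auto)
  qed (use W0 \<delta> in simp)
  also have "\<dots> \<le> ?r + real l * ?r" using first by simp
  also have "\<dots> = real (Suc l) * ?r" by (simp only: of_nat_Suc distrib_right mult_1)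
  finally show ?case .
qed simp

text \<open>All unit degrees are at least 1, and \<open>U\<close> consists of
  \<open>m * card U\<close> unit vertices; this bounds the chance of each step to end in
  \<open>U\<close> from below.\<close>

lemma prob_run_cover:
  assumes "n \<ge> 2" "pa_graph 1 n H" "U \<subseteq> {1..s}" "m * s \<le> n" "n + l \<le> m * Suc s"
    and "\<And>i. i \<in> {n + 1..n + l} \<Longrightarrow> block m i = Suc s" "AM H `` {Suc s} \<subseteq> U" "s \<ge> 1"
  shows "((1 + \<delta>) / (2 * (2 + \<delta>)) * real (card U) / real s) ^ l \<le>
    measure_pmf.prob (run e l n H) {G'. AM G' `` {Suc s} \<subseteq> U}"
  using assms
proof (induction l arbitrary: n H)
  case (Suc l)
  let ?q = "(1 + \<delta>) / (2 * (2 + \<delta>)) * real (card U) / real s"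
  have sub: "blocks U \<subseteq> {1..n}" using blocks(2)[OF Suc.prems(3)] Suc.prems(4) by force
  \<comment> \<open>Within a block the time is at most \<open>2 * m * s\<close>; hence the 2 in the
    constant.\<close>
  have "m * Suc s \<le> 2 * (m * s)" using Suc.prems(8) by simp
  then have "Suc n \<le> 2 * (m * s)" using Suc.prems(5) by linarith
  then have ns: "real (Suc n) \<le> 2 * (real m * real s)" by (metis of_nat_le_iff of_nat_mult of_nat_numeral)
  have "?q = (\<Sum>i\<in>blocks U. (1 + \<delta>) / (2 * (real m * real s) * (2 + \<delta>)))"
    using m by (simp add: blocks(3)[OF Suc.prems(3)] mult_ac)
  also have "\<dots> \<le> (\<Sum>i\<in>blocks U. pmf (e n H) i)"
  proof (rule sum_mono)
    fix i assume i: "i \<in> blocks U"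
    then have "1 \<le> vdegree H i" using sub Suc.prems(2) by (auto simp: pa_graph_def)
    then have d: "1 + \<delta> \<le> real (vdegree H i) + \<delta>" by simp
    have "(1 + \<delta>) / (2 * (real m * real s) * (2 + \<delta>)) \<le> (real (vdegree H i) + \<delta>) / (real (Suc n) * (2 + \<delta>))"
      using d ns \<delta> by (intro frac_le mult_right_mono mult_pos_pos) auto
    also have "\<dots> \<le> pmf (e n H) i" using pmf_ge[OF Suc.prems(1,2)] i sub by auto
    finally show "(1 + \<delta>) / (2 * (real m * real s) * (2 + \<delta>)) \<le> pmf (e n H) i" .
  qed
  also have "\<dots> = measure_pmf.prob (e n H) {j. block m j \<in> U}" by (rule prob_endpoint[OF Suc.prems(1-3), symmetric])
  finally have first: "?q \<le> measure_pmf.prob (e n H) {j. block m j \<in> U}" .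
  have q0: "0 \<le> ?q" using \<delta> by simp
  have "?q ^ Suc l \<le> measure_pmf.prob (e n H) {j. block m j \<in> U} * ?q ^ l"
    using mult_right_mono[OF first, of "?q ^ l"] q0 by (simp only: power_Suc zero_le_power)
  also have "\<dots> \<le> measure_pmf.prob (run e (Suc l) n H) {G'. AM G' `` {Suc s} \<subseteq> U}"
    unfolding run.simps(2)
  proof (rule prob_bind_ge)
    fix j assume j: "j \<in> set_pmf (e n H)" "j \<in> {j. block m j \<in> U}"
    have v: "block m (Suc n) = Suc s" using Suc.prems(6)[of "Suc n"] by simp
    show "?q ^ l \<le> measure_pmf.prob (run e l (Suc n) (add_vertex (Suc n) [j] H)) {G'. AM G' `` {Suc s} \<subseteq> U}"
    proof (rule Suc.IH)
      show "pa_graph 1 (Suc n) (add_vertex (Suc n) [j] H)" by (rule pa_add[OF Suc.prems(1,2) j(1)])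
      show "AM (add_vertex (Suc n) [j] H) `` {Suc s} \<subseteq> U"
        unfolding AM_add v using Suc.prems(3,7) j(2) by auto
    qed (use Suc.prems in auto)
  qed
  finally show ?case .
qed simp

text \<open>One step is a block of \<open>m\<close> unit steps. A merged vertex of degree at most
  \<open>3 * m\<close> has weight at most \<open>3 * m + m * \<bar>\<delta>\<bar>\<close>, and the
  number \<open>m\<close> of steps cancels the \<open>m\<close> in the time
  \<open>m * s\<close>.\<close>

lemma attachment_merge:
  "attachment m (max 8 ((3 * real m + real m * \<bar>\<delta>\<bar>) / (2 + \<delta>))) ((1 + \<delta>) / (2 * (2 + \<delta>)))
    (\<lambda>s. M (m * s)) (\<lambda>s. run e m (m * s)) AM (block_degree m)"
    (is "attachment m ?C ?c _ _ _ _")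
proof
  show "2 \<le> m" by (rule m)
  show "8 \<le> ?C" by simp
  show "0 < ?c" "?c \<le> 1" using \<delta> by auto
  fix s :: nat assume s: "2 \<le> s"
  have ms: "2 \<le> m * s" using mult_le_mono[OF m s] by simp
  show "M (m * Suc s) = M (m * s) \<bind> run e m (m * s)"
    using M_add[OF ms, of m] by (simp add: add.commute)
  fix G assume "G \<in> set_pmf (M (m * s))"
  then have paG: "pa_graph 1 (m * s) G" using pa ms by blast
  show A: "AM G \<subseteq> {1..s} \<times> {1..s}" by (rule AM_pa_graph[OF paG])
  have bl: "block m i = Suc s" if "i \<in> {m * s + 1..m * s + m}" for i
    using block_eq_iff[of m i "Suc s"] m that by simp
  \<comment> \<open>The vertex of the block has no edges yet, as needed to start
    \<open>prob_run_hit\<close> and \<open>prob_run_cover\<close>.\<close>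
  have new: "AM G `` {Suc s} = {}" using A by auto
  {
    fix G' assume G': "G' \<in> set_pmf (run e m (m * s) G)"
    obtain js where js: "length js = m" "set js \<subseteq> {1..m * s + m}"
      "AM G' = AM G \<union> {Suc s} \<times> block m ` set js \<union> (block m ` set js) \<times> {Suc s}"
      "\<And>u. block_degree m G' u = block_degree m G u + (if u = Suc s then m else 0) +
        length (filter (\<lambda>j. block m j = u) js)"
      using set_pmf_run[OF ms paG G' bl] by auto
    have B: "AM G' `` {Suc s} = block m ` set js" unfolding js(3) using new by auto
    have "block m j \<in> {1..Suc s}" if "j \<in> set js" for j
      using subsetD[OF js(2) that] m by (intro block_in_interval) (auto simp: algebra_simps)
    then have B1: "block m ` set js \<subseteq> {1..Suc s}" by auto
    have B2: "card (block m ` set js) \<le> m"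
      using card_image_le[of "set js" "block m"] card_length[of js] js(1) by simp
    have B3: "block m ` set js \<noteq> {}" using js(1) m by auto
    have new_deg: "block_degree m G (Suc s) = 0"
      unfolding block_degree_def by (intro sum.neutral ballI vdegree_eq_0[OF paG]) auto
    have le: "length (filter Q js) \<le> m" for Q using length_filter_le[of Q js] js(1) by simp
    have notin: "length (filter (\<lambda>j. block m j = u) js) = 0" if "u \<notin> block m ` set js" for u
      using that by (auto simp: filter_empty_conv)
    show "attached m (Suc s) (AM G) (block_degree m G) (AM G') (block_degree m G')"
      unfolding attached_def B
      using B1 B2 B3 js(3) new_deg le notin by (auto simp: js(4))
  }
  {
    fix T assume T: "T \<subseteq> {1..s}" "\<And>u. u \<in> T \<Longrightarrow> block_degree m G u \<le> 3 * m"
    have "(\<Sum>u\<in>T. real (block_degree m G u) + real m * \<delta>) \<le> (\<Sum>u\<in>T. 3 * real m + real m * \<bar>\<delta>\<bar>)"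
    proof (rule sum_mono)
      fix u assume "u \<in> T"
      then have "real (block_degree m G u) \<le> real (3 * m)" using T(2) by (intro of_nat_mono)
      moreover have "real m * \<delta> \<le> real m * \<bar>\<delta>\<bar>" by (intro mult_left_mono) auto
      ultimately show "real (block_degree m G u) + real m * \<delta> \<le> 3 * real m + real m * \<bar>\<delta>\<bar>" by simp
    qed
    then have "measure_pmf.prob (run e m (m * s) G) {G'. AM G' `` {Suc s} \<inter> T \<noteq> {}} \<le>
        real m * (real (card T) * (3 * real m + real m * \<bar>\<delta>\<bar>) / (real (m * s) * (2 + \<delta>)))"
      using new s by (intro prob_run_hit[OF ms paG T(1) order_refl bl]) auto
    also have "\<dots> = (3 * real m + real m * \<bar>\<delta>\<bar>) / (2 + \<delta>) * real (card T) / real s"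
      using m by (simp add: mult_ac)
    also have "\<dots> \<le> ?C * real (card T) / real s"
      by (intro divide_right_mono mult_right_mono) auto
    finally show "measure_pmf.prob (run e m (m * s) G) {G'. AM G' `` {Suc s} \<inter> T \<noteq> {}} \<le> ?C * real (card T) / real s" .
  }
  {
    fix U assume U: "U \<subseteq> {1..s}"
    show "(?c * real (card U) / real s) ^ m \<le> measure_pmf.prob (run e m (m * s) G) {G'. AM G' `` {Suc s} \<subseteq> U}"
      using new s by (intro prob_run_cover[OF ms paG U order_refl _ bl]) auto
  }
qed

lemma verts_merge:
  assumes "t \<ge> 2" "G \<in> set_pmf (M (m * t))"
  shows "verts (merge m G) = {1..t}"
proof -
  have ms: "2 \<le> m * t" using mult_le_mono[OF m assms(1)] by simp
  have "verts G = {1..m * t}" using pa[OF ms assms(2)] by (simp add: pa_graph_def)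
  moreover have "block m ` {1..m * t} = {1..t}"
  proof
    show "block m ` {1..m * t} \<subseteq> {1..t}"
      using m by (intro image_subsetI block_in_interval) auto
    show "{1..t} \<subseteq> block m ` {1..m * t}"
    proof
      fix u assume u: "u \<in> {1..t}"
      then obtain u' where "u = Suc u'" by (cases u) auto
      then have "block m (m * u) = u" using block_eq_iff[of m "m * u" u] m by simp
      moreover have "m * u \<in> {1..m * t}" using u m by auto
      ultimately show "u \<in> block m ` {1..m * t}" by (metis image_eqI)
    qed
  qed
  ultimately show ?thesis by (simp add: merge_def)
qed

end

section \<open>Unit steps of models (a) and (b)\<close>

lemma unit_attachment_PA1_a:
  assumes "m \<ge> 2" "\<delta> > - 1"
  shows "unit_attachment m \<delta> (endpoint_loop \<delta>) (PA1_a \<delta>)"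
proof
  fix n :: nat assume n: "2 \<le> n"
  show "PA1_a \<delta> (Suc n) = PA1_a \<delta> n \<bind> (\<lambda>G. map_pmf (\<lambda>j. add_vertex (Suc n) [j] G) (endpoint_loop \<delta> n G))"
    using n by (simp add: PA1_a_def)
  show "pa_graph 1 n G" if "G \<in> set_pmf (PA1_a \<delta> n)" for G
    using pa_graph_PA1_a[OF assms(2) _ that] n by simp
  fix G assume G: "pa_graph 1 n G"
  have pmf: "pmf (endpoint_loop \<delta> n G) i =
    (if i \<in> {1..n} then (real (vdegree G i) + \<delta>) / (real n * (2 + \<delta>) + (1 + \<delta>))
     else if i = n + 1 then (1 + \<delta>) / (real n * (2 + \<delta>) + (1 + \<delta>)) else 0)" for i
    using pmf_endpoint_loop[OF G] n assms by simp
  show "set_pmf (endpoint_loop \<delta> n G) \<subseteq> {1..Suc n}"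
    by (auto simp: set_pmf_eq_pos pmf split: if_splits)
  fix i assume i: "i \<in> {1..n}"
  then have "1 \<le> vdegree G i" using G by (auto simp: pa_graph_def)
  then have d: "0 \<le> real (vdegree G i) + \<delta>" using assms by linarith
  have pos: "0 < real n * (2 + \<delta>)" using n assms by simp
  then have pos': "0 < real n * (2 + \<delta>) + (1 + \<delta>)" using assms by linarith
  show "(real (vdegree G i) + \<delta>) / (real (Suc n) * (2 + \<delta>)) \<le> pmf (endpoint_loop \<delta> n G) i"
    using i d pos pos' assms by (simp only: pmf if_True, intro divide_left_mono mult_pos_pos) (auto simp: algebra_simps)
  show "pmf (endpoint_loop \<delta> n G) i \<le> (real (vdegree G i) + \<delta>) / (real n * (2 + \<delta>))"
    using i d pos pos' assms by (simp only: pmf if_True, intro divide_left_mono mult_pos_pos) auto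
qed (use assms in auto)

lemma unit_attachment_PA1_b:
  assumes "m \<ge> 2" "\<delta> > - 1"
  shows "unit_attachment m \<delta> (endpoint_old 1 \<delta>) (PA1_b \<delta>)"
proof
  fix n :: nat assume n: "2 \<le> n"
  show "PA1_b \<delta> (Suc n) = PA1_b \<delta> n \<bind> (\<lambda>G. map_pmf (\<lambda>j. add_vertex (Suc n) [j] G) (endpoint_old 1 \<delta> n G))"
    using n by (simp add: PA1_b_def)
  show "pa_graph 1 n G" if "G \<in> set_pmf (PA1_b \<delta> n)" for G
    using pa_graph_PA1_b[OF assms(2) n that] .
  fix G assume G: "pa_graph 1 n G"
  have pmf: "pmf (endpoint_old 1 \<delta> n G) i =
    (if i \<in> {1..n} then (real (vdegree G i) + \<delta>) / (real n * (2 + \<delta>)) else 0)" for i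
    using pmf_endpoint_old[OF G, of \<delta> i] n assms by simp
  show "set_pmf (endpoint_old 1 \<delta> n G) \<subseteq> {1..Suc n}"
    by (auto simp: set_pmf_eq_pos pmf[simplified] split: if_splits)
  fix i assume i: "i \<in> {1..n}"
  then have "1 \<le> vdegree G i" using G by (auto simp: pa_graph_def)
  then have d: "0 \<le> real (vdegree G i) + \<delta>" using assms by linarith
  have pos: "0 < real n * (2 + \<delta>)" using n assms by simp
  show "(real (vdegree G i) + \<delta>) / (real (Suc n) * (2 + \<delta>)) \<le> pmf (endpoint_old 1 \<delta> n G) i"
    using i d pos assms by (simp only: pmf if_True, intro divide_left_mono mult_pos_pos) (auto simp: algebra_simps)
  show "pmf (endpoint_old 1 \<delta> n G) i \<le> (real (vdegree G i) + \<delta>) / (real n * (2 + \<delta>))"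
    using i by (simp add: pmf[simplified])
qed (use assms in auto)

theorem theorem1p7:
  fixes m :: nat and \<delta> \<epsilon> :: real and PA :: "nat \<Rightarrow> real \<Rightarrow> nat \<Rightarrow> multigraph pmf"
  assumes "m \<ge> 2" and "\<delta> > - real m"
    and "PA \<in> {PA_a, PA_b, PA_c}"
    and "0 < \<epsilon>" and "\<epsilon> < 1"
  shows "(\<lambda>t. measure_pmf.prob (PA m \<delta> t)
            {G. \<epsilon> / ln (real m) * ln (ln (real t)) \<le> real (diam G)}) \<longlonglongrightarrow> 1"
proof -
  \<comment> \<open>Models (a) and (b) differ only in the unit chain, so one argument serves
    both.\<close>
  have merged: "(\<lambda>t. measure_pmf.prob (map_pmf (merge m) (M (m * t)))
      {G. \<epsilon> / ln (real m) * ln (ln (real t)) \<le> real (diam G)}) \<longlonglongrightarrow> 1"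
    if "unit_attachment m (\<delta> / real m) e M" for e M
  proof -
    interpret unit_attachment m "\<delta> / real m" e M by (rule that)
    show ?thesis
      by (rule attachment.whp_diam[OF attachment_merge assms(4,5)]) (simp add: verts_merge)
  qed
  have \<delta>': "\<delta> / real m > - 1" using assms(1,2) by (simp add: field_simps)
  from assms(3) consider "PA = PA_a" | "PA = PA_b" | "PA = PA_c" by blast
  then show ?thesis
  proof cases
    case 1
    show ?thesis unfolding 1 PA_a_def by (rule merged[OF unit_attachment_PA1_a[OF assms(1) \<delta>']])
  next
    case 2
    show ?thesis unfolding 2 PA_b_def by (rule merged[OF unit_attachment_PA1_b[OF assms(1) \<delta>']])
  next
    case 3
    \<comment> \<open>In model (c) the state is already the graph, so \<open>h\<close> is the
      identity.\<close>
    have "verts (id G) = {1..t} \<and> adjacency (id G) = adjacency G" if "t \<ge> 2" "G \<in> set_pmf (PA_c m \<delta> t)" for t G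
      using pa_graph_PA_c[of m \<delta> t G] assms(1,2) that by (simp add: pa_graph_def)
    from attachment.whp_diam[OF attachment_PA_c[OF assms(1,2)] assms(4,5) this] show ?thesis
      unfolding 3 by simp
  qed
qed

end
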